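(* Let $(\Omega,\mathscr F,\mathbb P)$ be a probability space, let $(\mathcal Y,\lVert\cdot\rVert_{\mathcal Y})$ be a separable $\mathbb R$-Banach space, let $\mathfrak z,\gamma\in[0,\infty)$, $\mathfrak B,\kappa,C\in[1,\infty)$, $c\in(0,\infty)$, $\Theta=\bigcup_{n=1}^\infty\mathbb Z^n$, $(M_j)_{j\in\mathbb N}\subseteq\mathbb N$, $y,\mathfrak y_{-1},\mathfrak y_0\in\mathcal Y$ satisfy $\liminf_{j\to\infty}M_j=\infty$, $\sup_{j\in\mathbb N}M_{j+1}/M_j\le\mathfrak B$, and $\sup_{j\in\mathbb N}M_j/j\le\kappa$. Let $(\mathcal Z,\mathscr Z)$ be a measurable space, let $Z^\theta\colon\Omega\to\mathcal Z$, $\theta\in\Theta$, be i.i.d. $\mathscr F/\mathscr Z$-measurable functions, let $(\mathcal H,\langle\cdot,\cdot\rangle_{\mathcal H},\lVert\cdot\rVert_{\mathcal H})$ be a separable $\mathbb R$-Hilbert space, let $\mathscr S$ be the $\sigma$-algebra on $L(\mathcal Y,\mathcal H)$ generated by the sets $\{\varphi\in L(\mathcal Y,\mathcal H)\colon\varphi(x)\in\mathcal B\}$, $x\in\mathcal Y$, $\mathcal B\in\mathscr B(\mathcal H)$, let $\psi_k\colon\Omega\to L(\mathcal Y,\mathcal H)$, $k\in\mathbb N_0$, be $\mathscr F/\mathscr S$-measurable functions, and assume that $(Z^\theta)_{\theta\in\Theta}$ and $(\psi_k)_{k\in\mathbb N_0}$ are independent. Let $\Phi_l\colon\mathcal Y\times\mathcal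 Y\times\mathcal Z\to\mathcal Y$, $l\in\mathbb N_0$, be $(\mathscr B(\mathcal Y)\otimes\mathscr B(\mathcal Y)\otimes\mathscr Z)/\mathscr B(\mathcal Y)$-measurable functions. Let $Y^\theta_{n,j}\colon\Omega\to\mathcal Y$, $\theta\in\Theta$, $j\in\mathbb N$, $n\in\mathbb N_0\cup\{-1\}$, satisfy for all $n,j\in\mathbb N$, $\theta\in\Theta$ that $Y^\theta_{-1,j}=\mathfrak y_{-1}$, $Y^\theta_{0,j}=\mathfrak y_0$, and $$Y^\theta_{n,j}=\sum_{l=0}^{n-1}\frac1{(M_j)^{n-l}}\Biggl[\sum_{i=1}^{(M_j)^{n-l}}\Phi_l\bigl(Y^{(\theta,l,i)}_{l,j},Y^{(\theta,-l,i)}_{l-1,j},Z^{(\theta,l,i)}\bigr)\Biggr].$$ Let $(\mathrm{Cost}_{n,j})_{(n,j)\in(\mathbb N_0\cup\{-1\})\times\mathbb N}\subseteq[0,\infty)$ satisfy for all $n,j\in\mathbb N$ that $\mathrm{Cost}_{-1,j}=\mathrm{Cost}_{0,j}=0$ and $$\mathrm{Cost}_{n,j}\le(M_j)^n\mathfrak z+\sum_{l=0}^{n-1}\bigl[(M_j)^{n-l}(\mathrm{Cost}_{l,j}+\mathrm{Cost}_{l-1,j}+\gamma\mathfrak z)\bigr].$$ Assume for all $k\in\mathbb N_0$, $n,j\in\mathbb N$, $u,v\in\mathcal Y$ that $\mathbb E[\lVert\Phi_k(Y^0_{k,j},Y^1_{k-1,j},Z^0)\rVert_{\mathcal Y}]<\infty$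 and $$\max\bigl\{\mathbb E[\lVert\psi_k(\Phi_0(\mathfrak y_0,\mathfrak y_{-1},Z^0))\rVert_{\mathcal H}^2],\ \mathbb 1_{\mathbb N}(k)\,\mathbb E[\lVert\psi_k(\mathfrak y_0-y)\rVert_{\mathcal H}^2]\bigr\}\le\frac{C^2}{k!},$$ $$\mathbb E[\lVert\psi_k(\Phi_n(u,v,Z^0))\rVert_{\mathcal H}^2]\le c\,\mathbb E[\lVert\psi_{k+1}(u-v)\rVert_{\mathcal H}^2],$$ $$\mathbb E\Bigl[\Bigl\lVert\psi_k\Bigl(y-\sum_{l=0}^{n-1}\mathbb E\bigl[\Phi_l(Y^0_{l,j},Y^1_{l-1,j},Z^0)\bigr]\Bigr)\Bigr\rVert_{\mathcal H}^2\Bigr]\le2c\,\mathbb E\bigl[\lVert\psi_{k+1}(Y^0_{n-1,j}-y)\rVert_{\mathcal H}^2\bigr].$$ Then (i) for all $n\in\mathbb N$: $\bigl(\mathbb E[\lVert\psi_0(Y^0_{n,n}-y)\rVert_{\mathcal H}^2]\bigr)^{1/2}\le C\bigl[\frac{e^\kappa(1+4c)}{M_n}\bigr]^{n/2}<\infty$; (ii) for all $n\in\mathbb N$: $\mathrm{Cost}_{n,n}\le(3+\gamma)^n(M_n)^n\mathfrak z$; and (iii) there exists $(N_\varepsilon)_{\varepsilon\in(0,1]}\subseteq\mathbb N$ such that for all $\varepsilon\in(0,1]$, $\delta\in(0,\infty)$ it holds that $\sup_{n\in\{N_\varepsilon,N_\varepsilon+1,\ldots\}}\bigl(\mathbb E[\lVert\psi_0(Y^0_{n,n}-y)\rVert_{\mathcal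 H}^2]\bigr)^{1/2}\le\varepsilon$ and $$\mathrm{Cost}_{N_\varepsilon,N_\varepsilon}\le\mathfrak z(3+\gamma)e^\kappa C^{2(1+\delta)}\Bigl(1+\sup_{n\in\mathbb N}\Bigl[\frac{[\mathfrak Be^{2\kappa}(3+\gamma)(1+4c)]^{(1+\delta)}}{(M_n)^\delta}\Bigr]^n\Bigr)\varepsilon^{-2(1+\delta)}<\infty.$$
   Context: $\mathbb N=\{1,2,3,\ldots\}$, $\mathbb N_0=\{0,1,2,\ldots\}$. For $\theta\in\mathbb Z^k\subseteq\Theta$ and $l,i\in\mathbb Z$, $(\theta,l,i)$ denotes the concatenated tuple in $\mathbb Z^{k+2}\subseteq\Theta$; the superscripts $0$ and $1$ denote the elements $0,1\in\mathbb Z^1\subseteq\Theta$. $\mathscr B(\cdot)$ is the Borel $\sigma$-algebra. $L(\mathcal Y,\mathcal H)$ is the space of continuous linear maps from $\mathcal Y$ to $\mathcal H$. For $\psi\colon\Omega\to L(\mathcal Y,\mathcal H)$ and $X\colon\Omega\to\mathcal Y$, $\psi(X)$ denotes the map $\omega\mapsto[\psi(\omega)](X(\omega))$. $\mathbb 1_{\mathbb N}(k)$ equals $1$ if $k\in\mathbb N$ and $0$ if $k=0$ (with $0\cdot\infty=0$). Expectations of $\mathcal Y$-valued random variables are Bochner integrals. *)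

theory Defs
  imports "HOL-Probability.Probability"
begin

definition Theta :: "int list set" where
  "Theta = (\<Union>n\<in>{1..}. {\<theta>. length \<theta> = n})"

definition strong_sigma ::
  "('y::real_normed_vector \<Rightarrow>\<^sub>L 'h::real_normed_vector) measure" where
  "strong_sigma =
     sigma UNIV {{\<phi>. blinfun_apply \<phi> x \<in> B} |x B. B \<in> sets borel}"

definition generated_sigma ::
  "'w measure \<Rightarrow> 'i set \<Rightarrow> 'b measure \<Rightarrow> ('i \<Rightarrow> 'w \<Rightarrow> 'b) \<Rightarrow> 'w set set" where
  "generated_sigma P I N X =
     sigma_sets (space P) (\<Union>i\<in>I. {X i -` A \<inter> space P |A. A \<in> sets N})"

(* Taken in [0,\<infinity>]: second moments in the hypotheses may be infinite, whereas the
   Bochner integral would return 0 for a non-integrable function. *)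
definition second_moment :: "'w measure \<Rightarrow> ('w \<Rightarrow> 'a::real_normed_vector) \<Rightarrow> ennreal" where
  "second_moment P X = (\<integral>\<^sup>+\<omega>. ennreal ((norm (X \<omega>))\<^sup>2) \<partial>P)"

definition ennreal_sqrt :: "ennreal \<Rightarrow> ennreal" where
  "ennreal_sqrt x = (if x = \<infinity> then \<infinity> else ennreal (sqrt (enn2real x)))"

end

theory Submission
  imports Defs
begin

text \<open>Fix \<open>j\<close> and put \<open>m = M j\<close>. As \<open>\<psi>\<close> is independent of the family \<open>Z\<close>, of which every approximation is a
  function, one may freeze the operator and split the mean square error into variance and squared
  bias. The summands of the recursion are independent, so the variance is at most the sum of the
  second moments of the terms, each divided by its sample size. The Lipschitz and bias hypotheses
  then bound the error \<open>e n k\<close> (at level \<open>n\<close>, measured with \<open>\<psi> k\<close>) by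
  \<open>C\<^sup>2 / (k! m^n) + 2 c \<Sum>_{0<l<n} m^(l-n) (e l (k+1) + e (l-1) (k+1)) + 2 c e (n-1) (k+1)\<close>, and
  induction gives \<open>e n k \<le> C\<^sup>2 (1+4c)^n m^(-n) \<Sum>_{i\<le>n} m^i / (k+i)!\<close>. For \<open>k = 0\<close> the last sum is at
  most \<open>exp m \<le> exp (\<kappa> j)\<close>. For (iii) take the least \<open>N\<close> from which on the bound (i) is at most \<open>\<epsilon>\<close>:
  unless \<open>N = 1\<close>, the bound at \<open>N - 1\<close> exceeds \<open>\<epsilon>\<close>, and the \<open>2 (1 + \<delta>)\<close>-th power of this inequality
  pays for the cost at \<open>N\<close>.\<close>

section \<open>Probabilistic preliminaries\<close>

text \<open>The Lipschitz hypothesis concerns deterministic arguments, while the recursion inserts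
  random iterates, and the operators \<open>\<psi> k\<close> are random too. Operators, iterates and
  fresh inputs therefore have to be separated. This is possible because labels only grow: an iterate
  labelled \<open>\<theta>\<close> reads inputs at strict extensions of \<open>\<theta>\<close>,
  hence not the input at \<open>\<theta>\<close> that enters \<open>\<Phi>\<close> next to it. The
  same bookkeeping gives equality in law and independence of the summands. Second moments are not
  known to be finite beforehand, so the error estimates live in [0,\<infinity>]; Banach space valued
  expectations of the scheme are taken only of values of \<open>\<Phi>\<close>, which are integrable
  by hypothesis. Each use of the Lipschitz or bias hypothesis replaces \<open>k\<close> by
  \<open>k + 1\<close>. Hence the induction has to treat all \<open>k\<close> at once, and the
  factorials at the shifted indices balance the powers of \<open>m\<close>.\<close>

lemma measurable_blinfun_apply_strong_sigma:
  fixes f :: "'a \<Rightarrow> ('y::{real_normed_vector, second_countable_topology} \<Rightarrow>\<^sub>L 'h::real_normed_vector)"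
  assumes f: "f \<in> measurable N strong_sigma" and g: "g \<in> borel_measurable N"
  shows "(\<lambda>\<omega>. f \<omega> (g \<omega>)) \<in> borel_measurable N"
proof -
  obtain F where F: "\<And>i. simple_function N (F i)" "\<And>x. x \<in> space N \<Longrightarrow> (\<lambda>i. F i x) \<longlonglongrightarrow> g x"
    using borel_measurable_implies_sequence_metric[OF g, of 0] by metis
  have const: "(\<lambda>\<omega>. f \<omega> x) \<in> borel_measurable N" for x
  proof (rule measurable_compose[OF f])
    show "(\<lambda>\<phi>. blinfun_apply \<phi> x) \<in> borel_measurable (strong_sigma :: ('y \<Rightarrow>\<^sub>L 'h) measure)"
    proof (rule measurableI)
      fix B :: "'h set" assume "B \<in> sets borel"
      then have "{\<phi>. blinfun_apply \<phi> x \<in> B}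
          \<in> {{\<phi> :: 'y \<Rightarrow>\<^sub>L 'h. blinfun_apply \<phi> x \<in> B} |x B. B \<in> sets borel}" by blast
      then show "(\<lambda>\<phi>. blinfun_apply \<phi> x) -` B \<inter> space (strong_sigma :: ('y \<Rightarrow>\<^sub>L 'h) measure)
          \<in> sets strong_sigma"
        by (auto simp: strong_sigma_def vimage_def)
    qed simp
  qed
  \<comment> \<open>\<open>strong_sigma\<close> only sees evaluations at fixed points. A simple
    function has finitely many values, so evaluation along it is glued from those; continuity of
    each single operator carries measurability over to the limit \<open>g\<close>.\<close>
  have "(\<lambda>\<omega>. f \<omega> (F i \<omega>)) \<in> borel_measurable N" for i
  proof (rule measurable_compose_countable'[where I = "F i ` space N"])
    show "countable (F i ` space N)"
      using simple_functionD(1)[OF F(1)] by (rule countable_finite)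
    show "F i \<in> measurable N (count_space (F i ` space N))"
      using F(1)[of i] by (auto intro!: measurableI simp: simple_function_def)
        (metis F(1) simple_functionD(2) simple_function_def)
  qed (rule const)
  then show ?thesis
  proof (rule borel_measurable_LIMSEQ_metric)
    fix x assume "x \<in> space N"
    then show "(\<lambda>i. f x (F i x)) \<longlonglongrightarrow> f x (g x)"
      by (intro tendsto_intros F)
  qed
qed

section \<open>Independence, variance, and laws of i.i.d. families\<close>

context prob_space
begin

text \<open>The library's \<open>indep_var\<close> forces both random variables into the same type, hence the
  formulation by means of \<open>indep_set\<close>.\<close>

lemma nn_integral_indep_Fubini:
  fixes X :: "'a \<Rightarrow> 'x" and A :: "'a \<Rightarrow> 'z"
  assumes X: "X \<in> measurable M S" and A: "A \<in> measurable M T"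
    and ind: "indep_set {X -` a \<inter> space M |a. a \<in> sets S} {A -` b \<inter> space M |b. b \<in> sets T}"
    and f: "f \<in> borel_measurable (S \<Otimes>\<^sub>M T)"
  shows "(\<integral>\<^sup>+\<omega>. f (X \<omega>, A \<omega>) \<partial>M) = (\<integral>\<^sup>+\<omega>. \<integral>\<^sup>+\<omega>'. f (X \<omega>, A \<omega>') \<partial>M \<partial>M)"
proof -
  interpret DX: prob_space "distr M S X" by (rule prob_space_distr) fact
  interpret D: prob_space "distr M T A" by (rule prob_space_distr) fact
  have eq: "distr M S X \<Otimes>\<^sub>M distr M T A = distr M (S \<Otimes>\<^sub>M T) (\<lambda>x. (X x, A x))"
  proof (rule pair_measure_eqI)
    fix a b assume "a \<in> sets (distr M S X)" "b \<in> sets (distr M T A)"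
    then have ab: "a \<in> sets S" "b \<in> sets T" by auto
    then have "prob ((X -` a \<inter> space M) \<inter> (A -` b \<inter> space M))
        = prob (X -` a \<inter> space M) * prob (A -` b \<inter> space M)"
      using ind unfolding indep_sets2_eq by blast
    moreover have "(\<lambda>x. (X x, A x)) -` (a \<times> b) \<inter> space M = (X -` a \<inter> space M) \<inter> (A -` b \<inter> space M)"
      by auto
    ultimately show "emeasure (distr M S X) a * emeasure (distr M T A) b
        = emeasure (distr M (S \<Otimes>\<^sub>M T) (\<lambda>x. (X x, A x))) (a \<times> b)"
      using X A ab by (simp add: emeasure_distr measurable_Pair emeasure_eq_measure ennreal_mult)
  qed (auto intro: DX.sigma_finite_measure_axioms D.sigma_finite_measure_axioms sets_pair_measure_cong)
  have [measurable]: "f \<in> borel_measurable (distr M S X \<Otimes>\<^sub>M distr M T A)"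
    using f by (simp cong: measurable_cong_sets)
  have "(\<integral>\<^sup>+\<omega>. f (X \<omega>, A \<omega>) \<partial>M) = (\<integral>\<^sup>+p. f p \<partial>(distr M S X \<Otimes>\<^sub>M distr M T A))"
    unfolding eq using X A f by (subst nn_integral_distr) auto
  also have "\<dots> = (\<integral>\<^sup>+x. \<integral>\<^sup>+a. f (x, a) \<partial>distr M T A \<partial>distr M S X)"
    by (rule D.nn_integral_fst[symmetric]) measurable
  also have "\<dots> = (\<integral>\<^sup>+x. \<integral>\<^sup>+\<omega>'. f (x, A \<omega>') \<partial>M \<partial>distr M S X)"
    using A f by (intro nn_integral_cong nn_integral_distr) auto
  also have "\<dots> = (\<integral>\<^sup>+\<omega>. \<integral>\<^sup>+\<omega>'. f (X \<omega>, A \<omega>') \<partial>M \<partial>M)"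
  proof (rule nn_integral_distr[OF X])
    have "(\<lambda>p. (fst p, A (snd p))) \<in> measurable (S \<Otimes>\<^sub>M M) (S \<Otimes>\<^sub>M T)"
      using A by measurable
    from measurable_compose[OF this f]
    have "(\<lambda>(x, \<omega>'). f (x, A \<omega>')) \<in> borel_measurable (S \<Otimes>\<^sub>M M)"
      by (simp add: split_beta')
    from borel_measurable_nn_integral[OF this]
    show "(\<lambda>x. \<integral>\<^sup>+\<omega>'. f (x, A \<omega>') \<partial>M) \<in> borel_measurable (distr M S X)"
      by simp
  qed
  finally show ?thesis .
qed

lemma indep_var_nn_integral_Fubini:
  assumes ind: "indep_var S X T A" and f: "f \<in> borel_measurable (S \<Otimes>\<^sub>M T)"
  shows "(\<integral>\<^sup>+\<omega>. f (X \<omega>, A \<omega>) \<partial>M) = (\<integral>\<^sup>+\<omega>. \<integral>\<^sup>+\<omega>'. f (X \<omega>, A \<omega>') \<partial>M \<partial>M)"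
proof (rule nn_integral_indep_Fubini)
  show "indep_set {X -` a \<inter> space M |a. a \<in> sets S} {A -` b \<inter> space M |b. b \<in> sets T}"
    using ind unfolding indep_var_eq indep_sets2_eq by (blast intro: sigma_sets.Basic)
qed (use ind f in \<open>auto simp: indep_var_eq\<close>)

text \<open>First moments suffice for the product: under the product law, integrating
  \<open>norm (\<phi> x \<bullet> \<phi> a)\<close> over \<open>a\<close> leaves at most a multiple
  of \<open>norm x\<close>. So Fubini applies, and expectation passes through the linear maps one
  variable at a time. This evaluates the mixed terms of a variance.\<close>

lemma indep_var_integral_inner_blinfun:
  fixes X A :: "'a \<Rightarrow> 'y::{banach, second_countable_topology}"
    and \<phi> :: "'y \<Rightarrow>\<^sub>L 'h::real_inner"
  assumes ind: "indep_var borel X borel A" and X: "integrable M X" and A: "integrable M A"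
  shows "integrable M (\<lambda>\<omega>. \<phi> (X \<omega>) \<bullet> \<phi> (A \<omega>))"
    and "(\<integral>\<omega>. \<phi> (X \<omega>) \<bullet> \<phi> (A \<omega>) \<partial>M) = \<phi> (\<integral>\<omega>. X \<omega> \<partial>M) \<bullet> \<phi> (\<integral>\<omega>. A \<omega> \<partial>M)"
proof -
  have mX[measurable]: "X \<in> borel_measurable M" and mA[measurable]: "A \<in> borel_measurable M"
    using X A by auto
  let ?S = "distr M borel X" and ?T = "distr M borel A"
  have eq: "?S \<Otimes>\<^sub>M ?T = distr M (borel \<Otimes>\<^sub>M borel) (\<lambda>x. (X x, A x))"
    using ind by (auto simp: indep_var_distribution_eq)
  have cont: "continuous_on UNIV (\<lambda>p. \<phi> (fst p) \<bullet> \<phi> (snd p))"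
    by (intro continuous_intros)
  then have bm: "(\<lambda>p. \<phi> (fst p) \<bullet> \<phi> (snd p)) \<in> borel_measurable (borel \<Otimes>\<^sub>M borel)"
    unfolding borel_prod by (rule borel_measurable_continuous_onI)
  interpret S: prob_space ?S by (rule prob_space_distr) fact
  interpret T: prob_space ?T by (rule prob_space_distr) fact
  interpret ST: pair_sigma_finite ?S ?T ..
  have iS: "integrable ?S (\<lambda>x. x)" and iT: "integrable ?T (\<lambda>x. x)"
    using X A by (auto simp: integrable_distr_eq)
  have lin: "bounded_linear (\<lambda>a. \<phi> x \<bullet> \<phi> a)" for x
    by (intro bounded_linear_intros)
  have lin': "bounded_linear (\<lambda>a. \<phi> a \<bullet> h)" for h
    by (intro bounded_linear_intros)
  have I: "integrable (?S \<Otimes>\<^sub>M ?T) (\<lambda>(x, a). \<phi> x \<bullet> \<phi> a)"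
  proof (rule ST.Fubini_integrable)
    show "(\<lambda>(x, a). \<phi> x \<bullet> \<phi> a) \<in> borel_measurable (?S \<Otimes>\<^sub>M ?T)"
      using bm by (simp add: split_beta' cong: measurable_cong_sets)
    show "AE x in ?S. integrable ?T (\<lambda>a. case (x, a) of (x, a) \<Rightarrow> \<phi> x \<bullet> \<phi> a)"
      using integrable_bounded_linear[OF lin iT] by simp
    have "integrable ?S (\<lambda>x. norm x * (norm \<phi> * norm \<phi> * (\<integral>a. norm a \<partial>?T)))"
      by (intro integrable_mult_left integrable_norm iS)
    then show "integrable ?S (\<lambda>x. \<integral>a. norm (case (x, a) of (x, a) \<Rightarrow> \<phi> x \<bullet> \<phi> a) \<partial>?T)"
    proof (rule Bochner_Integration.integrable_bound)
      have "(\<lambda>(x, a). norm (\<phi> x \<bullet> \<phi> a)) \<in> borel_measurable (?S \<Otimes>\<^sub>M ?T)"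
        using bm by (simp add: split_beta' cong: measurable_cong_sets)
      then show "(\<lambda>x. \<integral>a. norm (case (x, a) of (x, a) \<Rightarrow> \<phi> x \<bullet> \<phi> a) \<partial>?T) \<in> borel_measurable ?S"
        using T.borel_measurable_lebesgue_integral[of "\<lambda>x a. norm (\<phi> x \<bullet> \<phi> a)" ?S] by simp
      have "(\<integral>a. norm (\<phi> x \<bullet> \<phi> a) \<partial>?T)
          \<le> (\<integral>a. (norm x * norm \<phi> * norm \<phi>) * norm a \<partial>?T)" for x
      proof (rule integral_mono)
        show "integrable ?T (\<lambda>a. norm (\<phi> x \<bullet> \<phi> a))"
          by (intro integrable_norm integrable_bounded_linear[OF lin iT])
        show "integrable ?T (\<lambda>a. (norm x * norm \<phi> * norm \<phi>) * norm a)"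
          by (intro integrable_mult_right integrable_norm iT)
        fix a
        have "norm (\<phi> x \<bullet> \<phi> a) \<le> norm (\<phi> x) * norm (\<phi> a)"
          by (simp add: Cauchy_Schwarz_ineq2)
        also have "\<dots> \<le> (norm \<phi> * norm x) * (norm \<phi> * norm a)"
          by (intro mult_mono norm_blinfun) auto
        finally show "norm (\<phi> x \<bullet> \<phi> a) \<le> (norm x * norm \<phi> * norm \<phi>) * norm a"
          by (simp add: mult_ac)
      qed
      then show "AE x in ?S. norm (\<integral>a. norm (case (x, a) of (x, a) \<Rightarrow> \<phi> x \<bullet> \<phi> a) \<partial>?T)
          \<le> norm (norm x * (norm \<phi> * norm \<phi> * (\<integral>a. norm a \<partial>?T)))"
        by (intro AE_I2) (simp add: abs_mult mult_ac)
    qed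
  qed
  have bm': "(\<lambda>(x, a). \<phi> x \<bullet> \<phi> a) \<in> borel_measurable (borel \<Otimes>\<^sub>M borel)"
    using bm by (simp add: split_beta')
  show "integrable M (\<lambda>\<omega>. \<phi> (X \<omega>) \<bullet> \<phi> (A \<omega>))"
    using I bm' unfolding eq by (subst (asm) integrable_distr_eq) auto
  have "(\<integral>\<omega>. \<phi> (X \<omega>) \<bullet> \<phi> (A \<omega>) \<partial>M) = (\<integral>p. (case p of (x, a) \<Rightarrow> \<phi> x \<bullet> \<phi> a) \<partial>(?S \<Otimes>\<^sub>M ?T))"
    unfolding eq using bm' by (subst integral_distr) auto
  also have "\<dots> = (\<integral>x. \<integral>a. \<phi> x \<bullet> \<phi> a \<partial>?T \<partial>?S)"
    using ST.integral_fst'[OF I] by simp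
  also have "\<dots> = (\<integral>x. \<phi> x \<bullet> \<phi> (\<integral>a. a \<partial>?T) \<partial>?S)"
    by (simp add: integral_bounded_linear[OF lin iT])
  also have "\<dots> = \<phi> (\<integral>a. a \<partial>?S) \<bullet> \<phi> (\<integral>a. a \<partial>?T)"
    by (simp add: integral_bounded_linear[OF lin' iS])
  finally show "(\<integral>\<omega>. \<phi> (X \<omega>) \<bullet> \<phi> (A \<omega>) \<partial>M) = \<phi> (\<integral>\<omega>. X \<omega> \<partial>M) \<bullet> \<phi> (\<integral>\<omega>. A \<omega> \<partial>M)"
    by (simp add: integral_distr)
qed

text \<open>Variance plus squared bias, each variance enlarged to a second moment. Square
  integrability of \<open>\<phi> (X i)\<close> comes for free: where it fails, the right-hand side
  is infinite.\<close>

lemma second_moment_indep_sum_le: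
  fixes X :: "'i \<Rightarrow> 'a \<Rightarrow> 'y::{banach, second_countable_topology}"
    and \<phi> :: "'y \<Rightarrow>\<^sub>L 'h::real_inner"
  assumes I: "finite I" and ind: "indep_vars (\<lambda>_. borel) X I"
    and int: "\<And>i. i \<in> I \<Longrightarrow> integrable M (X i)"
  shows "second_moment M (\<lambda>\<omega>. \<phi> ((\<Sum>i\<in>I. X i \<omega>) - v))
    \<le> (\<Sum>i\<in>I. second_moment M (\<lambda>\<omega>. \<phi> (X i \<omega>)))
      + ennreal ((norm (\<phi> (v - (\<Sum>i\<in>I. \<integral>\<omega>. X i \<omega> \<partial>M))))\<^sup>2)"
proof (cases "\<exists>i\<in>I. second_moment M (\<lambda>\<omega>. \<phi> (X i \<omega>)) = \<top>")
  case True
  then have "(\<Sum>i\<in>I. second_moment M (\<lambda>\<omega>. \<phi> (X i \<omega>))) = \<top>"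
    using I by simp
  then show ?thesis by simp
next
  case False
  have mX[measurable]: "X i \<in> borel_measurable M" if "i \<in> I" for i
    using int[OF that] by auto
  define m where "m = (\<lambda>i. \<phi> (\<integral>\<omega>. X i \<omega> \<partial>M))"
  define E where "E = (\<lambda>i. \<integral>\<omega>. (norm (\<phi> (X i \<omega>)))\<^sup>2 \<partial>M)"
  have meas: "(\<lambda>\<omega>. (norm (\<phi> (X i \<omega>)))\<^sup>2) \<in> borel_measurable M" if "i \<in> I" for i
  proof -
    have "continuous_on UNIV (\<lambda>x. (norm (\<phi> x))\<^sup>2)"
      by (intro continuous_intros)
    from borel_measurable_continuous_onI[OF this] show ?thesis
      using mX[OF that] by measurable
  qed
  have sq: "integrable M (\<lambda>\<omega>. (norm (\<phi> (X i \<omega>)))\<^sup>2)" if "i \<in> I" for i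
    using False that meas[OF that]
    by (intro integrableI_nonneg) (auto simp: second_moment_def top.not_eq_extremum)
  have sm: "second_moment M (\<lambda>\<omega>. \<phi> (X i \<omega>)) = ennreal (E i)" if "i \<in> I" for i
    unfolding second_moment_def E_def using sq[OF that] by (intro nn_integral_eq_integral) auto
  \<comment> \<open>Diagonal and mixed entries share one formula, the product of the means plus a
    variance on the diagonal, so that the products of means can be resummed into a square.\<close>
  have pair: "integrable M (\<lambda>\<omega>. \<phi> (X i \<omega>) \<bullet> \<phi> (X j \<omega>)) \<and>
      (\<integral>\<omega>. \<phi> (X i \<omega>) \<bullet> \<phi> (X j \<omega>) \<partial>M) = m i \<bullet> m j + (if j = i then E i - (norm (m i))\<^sup>2 else 0)"
    if "i \<in> I" "j \<in> I" for i j
  proof (cases "j = i")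
    case True
    then show ?thesis using sq[OF that(1)]
      by (simp add: E_def power2_norm_eq_inner)
  next
    case False
    have "indep_var (PiM {i} (\<lambda>_. borel)) (\<lambda>\<omega>. \<lambda>i\<in>{i}. X i \<omega>) (PiM {j} (\<lambda>_. borel)) (\<lambda>\<omega>. \<lambda>j\<in>{j}. X j \<omega>)"
      using that False by (intro indep_var_restrict[OF ind]) auto
    from indep_var_compose[OF this, where ?Y1.0 = "\<lambda>f. f i" and ?Y2.0 = "\<lambda>f. f j" and ?N1.0 = borel and ?N2.0 = borel]
    have "indep_var borel (X i) borel (X j)"
      by (simp add: comp_def measurable_component_singleton)
    from indep_var_integral_inner_blinfun[OF this int int, of \<phi>] show ?thesis
      using that False by (simp add: m_def)
  qed
  have lin: "bounded_linear (\<lambda>a. \<phi> a \<bullet> \<phi> v)"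
    by (intro bounded_linear_intros)
  have single: "integrable M (\<lambda>\<omega>. \<phi> (X i \<omega>) \<bullet> \<phi> v) \<and> (\<integral>\<omega>. \<phi> (X i \<omega>) \<bullet> \<phi> v \<partial>M) = m i \<bullet> \<phi> v"
    if "i \<in> I" for i
    using integrable_bounded_linear[OF lin int[OF that]] integral_bounded_linear[OF lin int[OF that]]
    by (simp add: m_def)
  have expand: "(norm (\<phi> ((\<Sum>i\<in>I. x i) - v)))\<^sup>2
      = (\<Sum>i\<in>I. \<Sum>j\<in>I. \<phi> (x i) \<bullet> \<phi> (x j)) - 2 * (\<Sum>i\<in>I. \<phi> (x i) \<bullet> \<phi> v) + (norm (\<phi> v))\<^sup>2" for x
  proof -
    have "(norm ((\<Sum>i\<in>I. \<phi> (x i)) - \<phi> v))\<^sup>2 = (\<Sum>i\<in>I. \<phi> (x i)) \<bullet> (\<Sum>i\<in>I. \<phi> (x i))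
        - 2 * ((\<Sum>i\<in>I. \<phi> (x i)) \<bullet> \<phi> v) + (norm (\<phi> v))\<^sup>2"
      unfolding power2_norm_eq_inner by (simp add: inner_diff_left inner_diff_right inner_commute)
    then show ?thesis
      by (simp add: blinfun.diff_right blinfun.sum_right inner_sum_left inner_sum_right)
        (subst sum.swap, simp)
  qed
  have int_all: "integrable M (\<lambda>\<omega>. (norm (\<phi> ((\<Sum>i\<in>I. X i \<omega>) - v)))\<^sup>2)"
    unfolding expand using pair single
    by (intro Bochner_Integration.integrable_add Bochner_Integration.integrable_diff
        Bochner_Integration.integrable_sum integrable_mult_right) auto
  have "(\<integral>\<omega>. (norm (\<phi> ((\<Sum>i\<in>I. X i \<omega>) - v)))\<^sup>2 \<partial>M)
      = (\<Sum>i\<in>I. \<Sum>j\<in>I. m i \<bullet> m j + (if j = i then E i - (norm (m i))\<^sup>2 else 0))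
        - 2 * (\<Sum>i\<in>I. m i \<bullet> \<phi> v) + (norm (\<phi> v))\<^sup>2"
    unfolding expand using pair single
    by (simp add: prob_space)
  also have "\<dots> = (\<Sum>i\<in>I. E i - (norm (m i))\<^sup>2) +
      ((\<Sum>i\<in>I. \<Sum>j\<in>I. m i \<bullet> m j) - 2 * (\<Sum>i\<in>I. m i \<bullet> \<phi> v) + (norm (\<phi> v))\<^sup>2)"
    using I by (simp add: sum.distrib)
  \<comment> \<open>Read backwards at the expectations, \<open>expand\<close> turns the bracket into
    the squared bias.\<close>
  also have "\<dots> \<le> (\<Sum>i\<in>I. E i) + (norm (\<phi> ((\<Sum>i\<in>I. \<integral>\<omega>. X i \<omega> \<partial>M) - v)))\<^sup>2"
    unfolding expand m_def by (intro add_right_mono sum_mono) auto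
  finally have *: "(\<integral>\<omega>. (norm (\<phi> ((\<Sum>i\<in>I. X i \<omega>) - v)))\<^sup>2 \<partial>M)
      \<le> (\<Sum>i\<in>I. E i) + (norm (\<phi> (v - (\<Sum>i\<in>I. \<integral>\<omega>. X i \<omega> \<partial>M))))\<^sup>2"
    by (simp add: blinfun.diff_right norm_minus_commute)
  have E0: "0 \<le> E i" for i unfolding E_def by (intro integral_nonneg_AE) auto
  have "second_moment M (\<lambda>\<omega>. \<phi> ((\<Sum>i\<in>I. X i \<omega>) - v))
      = ennreal (\<integral>\<omega>. (norm (\<phi> ((\<Sum>i\<in>I. X i \<omega>) - v)))\<^sup>2 \<partial>M)"
    unfolding second_moment_def using int_all by (intro nn_integral_eq_integral) auto
  also have "\<dots> \<le> ennreal ((\<Sum>i\<in>I. E i) + (norm (\<phi> (v - (\<Sum>i\<in>I. \<integral>\<omega>. X i \<omega> \<partial>M))))\<^sup>2)"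
    using * by (rule ennreal_leI)
  also have "\<dots> = (\<Sum>i\<in>I. second_moment M (\<lambda>\<omega>. \<phi> (X i \<omega>)))
      + ennreal ((norm (\<phi> (v - (\<Sum>i\<in>I. \<integral>\<omega>. X i \<omega> \<partial>M))))\<^sup>2)"
    by (simp add: sm ennreal_plus sum_nonneg E0 sum_ennreal flip: ennreal_plus)
  finally show ?thesis .
qed

text \<open>Both sides are images of the same measure: an i.i.d. family has a power of the common
  law as joint law, and picking coordinates along an injection yields the power over
  \<open>S\<close>, whichever injection it is. \<open>S\<close> may be infinite, as it is for the
  iterates.\<close>

lemma distr_iid_reindex:
  assumes ind: "indep_vars (\<lambda>_. N) Z I"
    and ident: "\<And>i j. i \<in> I \<Longrightarrow> j \<in> I \<Longrightarrow> distr M N (Z i) = distr M N (Z j)"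
    and \<sigma>: "inj_on \<sigma> S" "\<sigma> ` S \<subseteq> I" and \<tau>: "inj_on \<tau> S" "\<tau> ` S \<subseteq> I"
    and f: "f \<in> measurable (PiM S (\<lambda>_. N)) L"
  shows "distr M L (\<lambda>\<omega>. f (\<lambda>s\<in>S. Z (\<sigma> s) \<omega>)) = distr M L (\<lambda>\<omega>. f (\<lambda>s\<in>S. Z (\<tau> s) \<omega>))"
\<comment> \<open>An empty \<open>S\<close> provides no index from which to take the common law, but
  then both sides are the law of a constant.\<close>
proof (cases "S = {}")
  case False
  then obtain i0 where i0: "i0 \<in> I" using \<sigma> by auto
  define \<mu> where "\<mu> = distr M N (Z i0)"
  have rv: "Z i \<in> measurable M N" if "i \<in> I" for i
    using ind that by (auto simp: indep_vars_def)
  have sets_\<mu>[measurable_cong, simp]: "sets \<mu> = sets N" by (simp add: \<mu>_def)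
  have "distr M (PiM I (\<lambda>_. N)) (\<lambda>\<omega>. \<lambda>i\<in>I. Z i \<omega>) = PiM I (\<lambda>i. distr M N (Z i))"
    using ind i0 rv by (subst (asm) indep_vars_iff_distr_eq_PiM') auto
  also have "\<dots> = PiM I (\<lambda>_. \<mu>)"
    using i0 by (intro PiM_cong) (auto simp: \<mu>_def intro: ident)
  finally have joint: "distr M (PiM I (\<lambda>_. N)) (\<lambda>\<omega>. \<lambda>i\<in>I. Z i \<omega>) = PiM I (\<lambda>_. \<mu>)" .
  have law: "distr M (PiM S (\<lambda>_. N)) (\<lambda>\<omega>. \<lambda>s\<in>S. Z (\<rho> s) \<omega>) = PiM S (\<lambda>_. \<mu>)"
    if \<rho>: "inj_on \<rho> S" "\<rho> ` S \<subseteq> I" for \<rho>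
  proof -
    have m1: "(\<lambda>w. \<lambda>s\<in>S. w (\<rho> s)) \<in> measurable (PiM I (\<lambda>_. N)) (PiM S (\<lambda>_. N))"
      using \<rho> by (intro measurable_restrict measurable_component_singleton) auto
    have m2: "(\<lambda>\<omega>. \<lambda>i\<in>I. Z i \<omega>) \<in> measurable M (PiM I (\<lambda>_. N))"
      using rv by (intro measurable_restrict)
    have "distr M (PiM S (\<lambda>_. N)) (\<lambda>\<omega>. \<lambda>s\<in>S. Z (\<rho> s) \<omega>)
        = distr M (PiM S (\<lambda>_. N)) ((\<lambda>w. \<lambda>s\<in>S. w (\<rho> s)) \<circ> (\<lambda>\<omega>. \<lambda>i\<in>I. Z i \<omega>))"
      using \<rho> by (intro distr_cong) (auto simp: fun_eq_iff restrict_def)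
    also have "\<dots> = distr (PiM I (\<lambda>_. \<mu>)) (PiM S (\<lambda>_. N)) (\<lambda>w. \<lambda>s\<in>S. w (\<rho> s))"
      using distr_distr[OF m1 m2] by (simp add: joint)
    also have "\<dots> = distr (PiM I (\<lambda>_. \<mu>)) (PiM S (\<lambda>_. \<mu>)) (\<lambda>w. \<lambda>s\<in>S. w (\<rho> s))"
      by (intro distr_cong sets_PiM_cong) auto
    also have "\<dots> = PiM S (\<lambda>_. \<mu>)"
      using \<rho> rv[OF i0] by (intro distr_PiM_reindex) (auto simp: \<mu>_def intro: prob_space_distr)
    finally show ?thesis .
  qed
  have "distr M L (\<lambda>\<omega>. f (\<lambda>s\<in>S. Z (\<rho> s) \<omega>)) = distr (PiM S (\<lambda>_. \<mu>)) L f"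
    if \<rho>: "inj_on \<rho> S" "\<rho> ` S \<subseteq> I" for \<rho>
  proof -
    have m2: "(\<lambda>\<omega>. \<lambda>s\<in>S. Z (\<rho> s) \<omega>) \<in> measurable M (PiM S (\<lambda>_. N))"
      using rv \<rho> by (intro measurable_restrict) auto
    show ?thesis
      using distr_distr[OF f m2] law[OF \<rho>] by (simp add: comp_def)
  qed
  from this[OF \<sigma>] this[OF \<tau>] show ?thesis by simp
qed (simp add: restrict_def)

end

section \<open>Rules for second moments\<close>

lemma second_moment_scaleR:
  assumes "X \<in> borel_measurable P"
  shows "second_moment P (\<lambda>\<omega>. a *\<^sub>R X \<omega>) = ennreal (a\<^sup>2) * second_moment P X"
  unfolding second_moment_def using assms
  by (simp add: power_mult_distrib ennreal_mult nn_integral_cmult)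

lemma second_moment_distr:
  assumes X: "X \<in> borel_measurable P" and X': "X' \<in> borel_measurable P"
    and eq: "distr P borel X = distr P borel X'" and f: "f \<in> borel_measurable borel"
  shows "second_moment P (\<lambda>\<omega>. f (X \<omega>)) = second_moment P (\<lambda>\<omega>. f (X' \<omega>))"
proof -
  have "second_moment P (\<lambda>\<omega>. f (A \<omega>)) = second_moment (distr P borel A) f"
    if "A \<in> borel_measurable P" for A
    unfolding second_moment_def using f that by (subst nn_integral_distr) auto
  then show ?thesis using X X' eq by simp
qed

lemma second_moment_cong:
  "(\<And>\<omega>. \<omega> \<in> space P \<Longrightarrow> X \<omega> = X' \<omega>) \<Longrightarrow> second_moment P X = second_moment P X'"
  unfolding second_moment_def by (intro nn_integral_cong) auto

lemma second_moment_diff_le: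
  assumes X: "X \<in> borel_measurable P" and X': "X' \<in> borel_measurable P"
  shows "second_moment P (\<lambda>\<omega>. X \<omega> - X' \<omega>) \<le> 2 * second_moment P X + 2 * second_moment P X'"
proof -
  have "ennreal ((norm (a - b))\<^sup>2) \<le> 2 * ennreal ((norm a)\<^sup>2) + 2 * ennreal ((norm b)\<^sup>2)" for a b :: 'b
  proof -
    have "(norm (a - b))\<^sup>2 \<le> (norm a + norm b)\<^sup>2"
      by (intro power_mono norm_triangle_ineq4) auto
    also have "\<dots> \<le> 2 * (norm a)\<^sup>2 + 2 * (norm b)\<^sup>2"
      using sum_squares_bound[of "norm a" "norm b"] by (simp add: power2_sum)
    finally have "ennreal ((norm (a - b))\<^sup>2) \<le> ennreal (2 * (norm a)\<^sup>2 + 2 * (norm b)\<^sup>2)"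
      by (rule ennreal_leI)
    then show ?thesis
      by (simp add: ennreal_mult')
  qed
  then have "second_moment P (\<lambda>\<omega>. X \<omega> - X' \<omega>)
      \<le> (\<integral>\<^sup>+\<omega>. 2 * ennreal ((norm (X \<omega>))\<^sup>2) + 2 * ennreal ((norm (X' \<omega>))\<^sup>2) \<partial>P)"
    unfolding second_moment_def by (intro nn_integral_mono) auto
  also have "\<dots> = 2 * second_moment P X + 2 * second_moment P X'"
    unfolding second_moment_def using X X' by (simp add: nn_integral_add nn_integral_cmult)
  finally show ?thesis .
qed

lemma Theta_iff: "\<theta> \<in> Theta \<longleftrightarrow> \<theta> \<noteq> []"
  by (auto simp: Theta_def Suc_le_eq)

section \<open>Deterministic estimates\<close>

text \<open>Origin of the factor \<open>1 + 4 * c\<close>. Write w for its powers: from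
  \<open>n\<close> to \<open>n + 1\<close> the new pair adds w_n + w_(n-1) and the last term changes
  by w_n - w_(n-1), so both sides grow by exactly 4 c w_n. The only loss is at \<open>n = 1\<close>,
  where 2 c is compared with 4 c.\<close>

lemma sum_geometric_pairs_le:
  fixes c :: real
  assumes "0 < c" "1 \<le> n"
  shows "2 * c * ((\<Sum>l = 1..<n. (1 + 4 * c) ^ l + (1 + 4 * c) ^ (l - 1)) + (1 + 4 * c) ^ (n - 1))
    \<le> (1 + 4 * c) ^ n - 1"
  using assms(2)
proof (induction n rule: dec_induct)
  case base
  then show ?case using assms(1) by simp
next
  case (step n)
  then obtain r where r: "n = Suc r" by (cases n) auto
  show ?case using step by (simp add: r algebra_simps)
qed

text \<open>The sum is built to reproduce itself: \<open>m\<close> times the sum for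
  \<open>k + 1\<close> consists of terms of the sum for \<open>k\<close> other than the one at
  \<open>i = 0\<close>, and that missing term is what the summand \<open>l = 0\<close> of the scheme
  contributes. At \<open>n = 0\<close> only \<open>C\<^sup>2 / fact k\<close> remains.\<close>

definition picard_bound :: "real \<Rightarrow> real \<Rightarrow> real \<Rightarrow> nat \<Rightarrow> nat \<Rightarrow> real" where
  "picard_bound c C m n k = C\<^sup>2 * (1 + 4 * c) ^ n / m ^ n * (\<Sum>i\<le>n. m ^ i / fact (k + i))"

lemma picard_bound_nonneg: "0 < c \<Longrightarrow> 0 \<le> m \<Longrightarrow> 0 \<le> picard_bound c C m n k"
  unfolding picard_bound_def by (intro mult_nonneg_nonneg divide_nonneg_nonneg sum_nonneg) auto

text \<open>All earlier bounds are estimated by multiples of one number \<open>D\<close>, built from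
  the sum for \<open>k\<close> without its first term. What remains are powers of
  \<open>1 + 4 * c\<close>, summed by \<open>sum_geometric_pairs_le\<close>.\<close>

lemma picard_bound_rec:
  assumes c: "0 < c" and m: "1 \<le> m" and n: "1 \<le> n"
  shows "1 / m ^ n * (C\<^sup>2 / fact k)
    + (\<Sum>l = 1..<n. 1 / m ^ (n - l) *
        (2 * c * (picard_bound c C m l (k + 1) + picard_bound c C m (l - 1) (k + 1))))
    + 2 * c * picard_bound c C m (n - 1) (k + 1) \<le> picard_bound c C m n k"
proof -
  let ?w = "\<lambda>l. (1 + 4 * c) ^ l" and ?B = "\<lambda>l. picard_bound c C m l (k + 1)"
  define R where "R = (\<Sum>i<n. m ^ Suc i / fact (k + Suc i))"
  define D where "D = C\<^sup>2 * R / m ^ n"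
  have R0: "0 \<le> R" unfolding R_def using m by (intro sum_nonneg) auto
  then have D0: "0 \<le> D" unfolding D_def using m by simp
  have B: "?B l \<le> C\<^sup>2 * ?w l / m ^ Suc l * R" if "l < n" for l
  proof -
    have "m * (\<Sum>i\<le>l. m ^ i / fact (k + 1 + i)) = (\<Sum>i\<le>l. m ^ Suc i / fact (k + Suc i))"
      by (simp add: sum_distrib_left)
    also have "\<dots> \<le> R"
      unfolding R_def using m that by (intro sum_mono2) auto
    finally have "(\<Sum>i\<le>l. m ^ i / fact (k + 1 + i)) \<le> R / m"
      using m by (simp add: field_simps)
    then have "?B l \<le> C\<^sup>2 * ?w l / m ^ l * (R / m)"
      unfolding picard_bound_def using c m by (intro mult_left_mono) auto
    then show ?thesis by (simp add: field_simps)
  qed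
  have B1: "1 / m ^ (n - l) * ?B l \<le> D * ?w l" if "l < n" for l
  proof -
    have "1 / m ^ (n - l) * ?B l \<le> 1 / m ^ (n - l) * (C\<^sup>2 * ?w l / m ^ Suc l * R)"
      using B[OF that] m by (intro mult_left_mono) auto
    also have "\<dots> = D * ?w l / m"
    proof -
      have "m ^ n = m ^ (n - l) * m ^ l" using that by (simp flip: power_add)
      then show ?thesis by (simp add: D_def mult_ac)
    qed
    also have "\<dots> \<le> D * ?w l"
      using mult_left_mono[OF m, of "D * ?w l"] D0 m c by (simp add: divide_le_eq)
    finally show ?thesis .
  qed
  \<comment> \<open>Level \<open>l - 1\<close> has one power of \<open>m\<close> too few in the
    denominator. The factor \<open>1 / m\<close> gained in \<open>B\<close> by shifting
    \<open>k + 1\<close> to \<open>k\<close> supplies it; \<open>B1\<close> had that factor to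
    spare.\<close>
  have B2: "1 / m ^ (n - l) * ?B (l - 1) \<le> D * ?w (l - 1)" if "1 \<le> l" "l \<le> n" for l
  proof -
    have "1 / m ^ (n - l) * ?B (l - 1) \<le> 1 / m ^ (n - l) * (C\<^sup>2 * ?w (l - 1) / m ^ Suc (l - 1) * R)"
      using B[of "l - 1"] that m by (intro mult_left_mono) auto
    also have "\<dots> = D * ?w (l - 1)"
    proof -
      have "m ^ n = m ^ (n - l) * m ^ Suc (l - 1)" using that by (simp flip: power_add power_Suc)
      then show ?thesis by (simp add: D_def del: power_Suc)
    qed
    finally show ?thesis .
  qed
  have "1 / m ^ (n - l) * (2 * c * (?B l + ?B (l - 1))) \<le> 2 * c * (D * (?w l + ?w (l - 1)))"
    if "l \<in> {1..<n}" for l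
  proof -
    have "1 / m ^ (n - l) * (?B l + ?B (l - 1)) \<le> D * (?w l + ?w (l - 1))"
      using B1[of l] B2[of l] that by (simp add: distrib_left)
    from mult_left_mono[OF this, of "2 * c"] show ?thesis
      using c by (simp only: mult.left_commute[of "2 * c"])
  qed
  then have "(\<Sum>l = 1..<n. 1 / m ^ (n - l) * (2 * c * (?B l + ?B (l - 1))))
      \<le> (\<Sum>l = 1..<n. 2 * c * (D * (?w l + ?w (l - 1))))"
    by (intro sum_mono)
  moreover have "2 * c * ?B (n - 1) \<le> 2 * c * (D * ?w (n - 1))"
    using B2[of n] n c by (simp add: mult_left_mono)
  ultimately have "(\<Sum>l = 1..<n. 1 / m ^ (n - l) * (2 * c * (?B l + ?B (l - 1)))) + 2 * c * ?B (n - 1)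
      \<le> D * (2 * c * ((\<Sum>l = 1..<n. ?w l + ?w (l - 1)) + ?w (n - 1)))"
    by (simp add: sum_distrib_left algebra_simps)
  also have "\<dots> \<le> D * (?w n - 1)"
    using sum_geometric_pairs_le[OF c n] D0 by (intro mult_left_mono)
  finally have 1: "(\<Sum>l = 1..<n. 1 / m ^ (n - l) * (2 * c * (?B l + ?B (l - 1)))) + 2 * c * ?B (n - 1)
      \<le> D * (?w n - 1)" .
  have "picard_bound c C m n k = C\<^sup>2 * ?w n / m ^ n * (1 / fact k + R)"
    unfolding picard_bound_def R_def by (simp add: sum.atMost_shift)
  also have "\<dots> = ?w n * (1 / m ^ n * (C\<^sup>2 / fact k)) + D * ?w n"
    by (simp add: D_def algebra_simps add_divide_distrib)
  also have "\<dots> \<ge> 1 / m ^ n * (C\<^sup>2 / fact k) + D * ?w n"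
    using mult_right_mono[of 1 "?w n" "1 / m ^ n * (C\<^sup>2 / fact k)"] c m
    by (simp only: mult_1 add_right_mono one_le_power) simp
  finally show ?thesis using 1 D0 by (simp add: algebra_simps)
qed

text \<open>With \<open>q = 3 + \<gamma>\<close> the increment \<open>q ^ Suc l - q ^ l\<close>
  equals \<open>(2 + \<gamma>) * q ^ l\<close>, enough for the two earlier costs and for
  \<open>\<gamma>\<close>. The sum over \<open>l \<ge> 1\<close> then telescopes to
  \<open>q ^ n - q\<close>, and this \<open>- q\<close> absorbs the \<open>1 + \<gamma>\<close> left
  by the first term and by \<open>l = 0\<close>.\<close>

lemma picard_cost_le:
  fixes M z \<gamma> :: real and Cost :: "int \<Rightarrow> real"
  assumes M: "1 \<le> M" and z: "0 \<le> z" and \<gamma>: "0 \<le> \<gamma>"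
    and Cost_m1: "Cost (-1) = 0" and Cost_0: "Cost 0 = 0"
    and Cost_rec: "\<And>n::nat. 1 \<le> n \<Longrightarrow> Cost (int n) \<le> M ^ n * z +
      (\<Sum>l = 0..<n. M ^ (n - l) * (Cost (int l) + Cost (int l - 1) + \<gamma> * z))"
    and n: "1 \<le> n"
  shows "Cost (int n) \<le> (3 + \<gamma>) ^ n * M ^ n * z"
  using n
proof (induction n rule: less_induct)
  case (less n)
  define q where "q = 3 + \<gamma>"
  have q: "1 \<le> q" using \<gamma> by (simp add: q_def)
  \<comment> \<open>The claim starts at \<open>n = 1\<close>; \<open>Cost 0 = 0\<close> extends it
    to \<open>l = 0\<close>.\<close>
  have IH: "Cost (int l) \<le> q ^ l * M ^ l * z" if "l < n" for l
    using less.IH[OF that] Cost_0 z q M by (cases "l = 0") (auto simp: q_def)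
  have step: "M ^ (n - l) * (Cost (int l) + Cost (int l - 1) + \<gamma> * z) \<le> M ^ n * z * (q ^ Suc l - q ^ l)"
    if l: "l \<in> {1..<n}" for l
  proof -
    have "Cost (int l - 1) \<le> q ^ (l - 1) * M ^ (l - 1) * z"
    proof -
      have "l - 1 < n" using l by auto
      from IH[OF this] show ?thesis using l by (simp add: of_nat_diff)
    qed
    also have "\<dots> \<le> q ^ (l - 1) * M ^ l * z"
      using M q z by (intro mult_right_mono mult_left_mono power_increasing) auto
    finally have "Cost (int l) + Cost (int l - 1) + \<gamma> * z
        \<le> q ^ l * M ^ l * z + q ^ (l - 1) * M ^ l * z + M ^ l * \<gamma> * z"
      using IH[of l] l M \<gamma> z by (intro add_mono) (auto simp: mult_le_cancel_right1 intro!: mult_right_mono)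
    also have "\<dots> = M ^ l * z * (q ^ l + q ^ (l - 1) + \<gamma>)"
      by (simp add: algebra_simps)
    also have "\<dots> \<le> M ^ l * z * (q ^ Suc l - q ^ l)"
    proof -
      have "q ^ (l - 1) \<le> q ^ l" "1 \<le> q ^ l"
        using q by (auto intro: power_increasing)
      moreover from this(2) have "\<gamma> * 1 \<le> \<gamma> * q ^ l"
        using \<gamma> by (intro mult_left_mono)
      moreover have "q ^ Suc l - q ^ l = q ^ l + q ^ l + \<gamma> * q ^ l"
        by (simp add: q_def algebra_simps)
      ultimately show ?thesis using M z by (intro mult_left_mono) auto
    qed
    finally have "M ^ (n - l) * (Cost (int l) + Cost (int l - 1) + \<gamma> * z)
        \<le> M ^ (n - l) * (M ^ l * z * (q ^ Suc l - q ^ l))"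
      using M by (intro mult_left_mono) auto
    also have "\<dots> = M ^ n * z * (q ^ Suc l - q ^ l)"
      using l by (simp flip: mult.assoc power_add)
    finally show ?thesis .
  qed
  have "Cost (int n) \<le> M ^ n * z + (\<Sum>l = 0..<n. M ^ (n - l) * (Cost (int l) + Cost (int l - 1) + \<gamma> * z))"
    by (rule Cost_rec[OF less.prems])
  also have "\<dots> = M ^ n * z * (1 + \<gamma>) + (\<Sum>l = 1..<n. M ^ (n - l) * (Cost (int l) + Cost (int l - 1) + \<gamma> * z))"
    using less.prems Cost_0 Cost_m1 by (simp add: sum.atLeast_Suc_lessThan algebra_simps)
  also have "\<dots> \<le> M ^ n * z * (1 + \<gamma>) + (\<Sum>l = 1..<n. M ^ n * z * (q ^ Suc l - q ^ l))"
    by (intro add_left_mono sum_mono step)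
  also have "\<dots> = M ^ n * z * (1 + \<gamma>) + M ^ n * z * (q ^ n - q)"
    unfolding sum_distrib_left[symmetric] using less.prems by (subst sum_Suc_diff') auto
  also have "\<dots> = M ^ n * z * q ^ n - 2 * (M ^ n * z)"
    by (simp add: q_def algebra_simps)
  also have "\<dots> \<le> q ^ n * M ^ n * z" using M z by (simp add: mult_ac)
  finally show ?case by (simp add: q_def)
qed

section \<open>From the recursive bounds to a rate and to a minimal index\<close>

lemma sum_power_over_fact_le_exp:
  fixes x :: real
  assumes "0 \<le> x"
  shows "(\<Sum>i\<le>n. x ^ i / fact i) \<le> exp x"
proof -
  have "(\<Sum>i\<le>n. x ^ i / fact i) \<le> (\<Sum>i. x ^ i / fact i)"
    using assms summable_exp[of x] by (intro sum_le_suminf) (auto simp: field_simps)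
  then show ?thesis by (simp add: exp_def divide_inverse mult.commute)
qed

lemma ennreal_sqrt_le:
  assumes "x \<le> ennreal (r\<^sup>2)" "0 \<le> r"
  shows "ennreal_sqrt x \<le> ennreal r"
proof -
  have "x \<noteq> \<infinity>" using assms(1) by (auto simp: top_unique)
  moreover have "enn2real x \<le> r\<^sup>2"
    using enn2real_mono[OF assms(1)] by simp
  then have "sqrt (enn2real x) \<le> r" using assms(2) real_le_lsqrt by auto
  ultimately show ?thesis by (simp add: ennreal_sqrt_def ennreal_leI)
qed

lemma picard_bound_le_rate:
  assumes c: "0 < c" and M: "1 \<le> M" "M \<le> \<kappa> * real n"
  shows "picard_bound c C M n 0 \<le> (C * (exp \<kappa> * (1 + 4 * c) / M) powr (real n / 2))\<^sup>2"
proof -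
  have "picard_bound c C M n 0 \<le> C\<^sup>2 * (1 + 4 * c) ^ n / M ^ n * exp (\<kappa> * real n)"
    unfolding picard_bound_def using c M sum_power_over_fact_le_exp[of M n]
    by (intro mult_left_mono) (auto intro: order_trans)
  also have "\<dots> = C\<^sup>2 * (exp \<kappa> * (1 + 4 * c) / M) ^ n"
    by (simp add: power_mult_distrib power_divide exp_of_nat2_mult mult_ac)
  also have "(exp \<kappa> * (1 + 4 * c) / M) ^ n = ((exp \<kappa> * (1 + 4 * c) / M) powr (real n / 2))\<^sup>2"
    using c M by (subst powr_realpow[symmetric]) (auto simp: power2_eq_square simp flip: powr_add)
  finally show ?thesis by (simp add: power_mult_distrib)
qed

text \<open>As soon as \<open>M n\<close> exceeds \<open>4 * A\<close>, the base is at most 1/4, and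
  its power \<open>n / 2\<close> is at most \<open>(1 / 2) ^ n\<close>.\<close>

lemma eventually_rate_le:
  fixes M :: "nat \<Rightarrow> nat"
  assumes M: "filterlim (\<lambda>n. real (M n)) at_top sequentially" and A: "0 < A" and \<epsilon>: "0 < \<epsilon>" and C: "0 \<le> C"
  shows "eventually (\<lambda>n. C * (A / real (M n)) powr (real n / 2) \<le> \<epsilon>) sequentially"
proof -
  have "(\<lambda>n. C * (1 / 2) ^ n) \<longlonglongrightarrow> C * 0"
    by (intro tendsto_intros LIMSEQ_power_zero) auto
  then have "eventually (\<lambda>n. C * (1 / 2) ^ n < \<epsilon>) sequentially"
    using \<epsilon> order_tendstoD(2) by fastforce
  moreover have "eventually (\<lambda>n. 4 * A \<le> real (M n)) sequentially"
    using M unfolding filterlim_at_top by blast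
  ultimately show ?thesis
  proof eventually_elim
    case (elim n)
    have pos: "0 < real (M n)" using elim(2) A by linarith
    have "A / real (M n) \<le> 1 / 4" using elim(2) pos by (simp add: field_simps)
    then have "(A / real (M n)) powr (real n / 2) \<le> (1 / 4) powr (real n / 2)"
      using A by (intro powr_mono2) auto
    also have "\<dots> = (1 / 2) ^ n"
    proof -
      have "(1 / 4 :: real) = (1 / 2) powr 2" by (simp add: power2_eq_square)
      then have "(1 / 4 :: real) powr (real n / 2) = (1 / 2) powr real n" by (simp only: powr_powr) simp
      then show ?thesis by (simp add: powr_realpow)
    qed
    finally have "C * (A / real (M n)) powr (real n / 2) \<le> C * (1 / 2) ^ n"
      using C by (rule mult_left_mono)
    with elim(1) show ?case by simp
  qed
qed

text \<open>From some index on \<open>M n powr \<delta>\<close> dominates \<open>D\<close>, so these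
  terms are at most 1; the finitely many earlier ones are bounded by their sum.\<close>

lemma SUP_power_quotient_finite:
  fixes M :: "nat \<Rightarrow> nat"
  assumes M: "filterlim (\<lambda>n. real (M n)) at_top sequentially" and D: "0 \<le> D" and \<delta>: "0 < \<delta>"
  shows "(SUP n\<in>{1..}. ennreal ((D / real (M n) powr \<delta>) ^ n)) < \<infinity>"
proof -
  let ?f = "\<lambda>n. (D / real (M n) powr \<delta>) ^ n"
  have f0: "0 \<le> ?f n" for n using D by simp
  have "eventually (\<lambda>n. max 1 (D powr (1 / \<delta>)) \<le> real (M n)) sequentially"
    using M unfolding filterlim_at_top by blast
  then obtain k where k: "\<And>n. k \<le> n \<Longrightarrow> max 1 (D powr (1 / \<delta>)) \<le> real (M n)"
    unfolding eventually_sequentially by blast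
  have "?f n \<le> 1 + (\<Sum>i<k. ?f i)" for n
  proof (cases "n < k")
    case True
    then have "?f n \<le> (\<Sum>i<k. ?f i)" using f0 by (intro member_le_sum) auto
    then show ?thesis by simp
  next
    case False
    then have Mn: "1 \<le> real (M n)" "D powr (1 / \<delta>) \<le> real (M n)" using k[of n] by auto
    have "D = (D powr (1 / \<delta>)) powr \<delta>" using D \<delta> by (simp add: powr_powr)
    also have "\<dots> \<le> real (M n) powr \<delta>" using Mn \<delta> by (intro powr_mono2) auto
    finally have "D / real (M n) powr \<delta> \<le> 1" using Mn by (simp add: divide_le_eq)
    then have "?f n \<le> 1" using D by (intro power_le_one) auto
    moreover have "0 \<le> (\<Sum>i<k. ?f i)" using f0 by (intro sum_nonneg) auto
    ultimately show ?thesis by simp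
  qed
  then have "(SUP n\<in>{1..}. ennreal (?f n)) \<le> ennreal (1 + (\<Sum>i<k. ?f i))"
    by (intro SUP_least ennreal_leI)
  then show ?thesis by (rule order.strict_trans1) simp
qed

text \<open>Here \<open>m\<close> is the predecessor of the minimal index, and \<open>M\<close>,
  \<open>M'\<close> are the sample sizes at \<open>m\<close> and \<open>Suc m\<close>. Since the
  rate at \<open>m\<close> exceeds \<open>\<epsilon>\<close>, their quotient to the power
  \<open>2 * (1 + \<delta>)\<close> is at least 1 and may multiply the cost. It contributes
  \<open>M\<close> to the power \<open>- (1 + \<delta>) * m\<close>; the cost consumes
  \<open>M ^ m\<close> of this, which leaves \<open>M powr \<delta>\<close> in the
  denominator.\<close>

lemma cost_of_minimal_index_le:
  fixes M M' :: real
  assumes M: "1 \<le> M" "0 \<le> M'" "M' \<le> B * M" "M' \<le> \<kappa> * real (Suc m)"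
    and B: "1 \<le> B" and \<kappa>: "1 \<le> \<kappa>" and q: "1 \<le> q" and c: "0 < c" and C: "1 \<le> C"
    and \<epsilon>: "0 < \<epsilon>" and \<delta>: "0 < \<delta>"
    and rate: "\<epsilon> < C * (exp \<kappa> * (1 + 4 * c) / M) powr (real m / 2)"
  shows "q ^ Suc m * M' ^ Suc m \<le> q * exp \<kappa> * C powr (2 * (1 + \<delta>)) *
    ((B * exp (2 * \<kappa>) * q * (1 + 4 * c)) powr (1 + \<delta>) / M powr \<delta>) ^ m * \<epsilon> powr (- 2 * (1 + \<delta>))"
proof -
  define A where "A = exp \<kappa> * (1 + 4 * c)"
  define p where "p = 1 + \<delta>"
  have A: "0 < A" using c by (simp add: A_def)
  have E: "1 \<le> q * exp \<kappa> * B"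
  proof -
    have "1 * 1 \<le> q * exp \<kappa>" using q \<kappa> by (intro mult_mono) auto
    then have "1 * 1 \<le> q * exp \<kappa> * B" using B by (intro mult_mono) auto
    then show ?thesis by simp
  qed
  have "1 \<le> C * (A / M) powr (real m / 2) / \<epsilon>"
    using rate \<epsilon> by (simp add: A_def)
  then have "1 \<le> (C * (A / M) powr (real m / 2) / \<epsilon>) powr (2 * p)"
    using \<delta> by (intro ge_one_powr_ge_zero) (auto simp: p_def)
  also have "\<dots> = C powr (2 * p) * ((A / M) powr p) ^ m * \<epsilon> powr (- 2 * p)"
  proof -
    have "((A / M) powr (real m / 2)) powr (2 * p) = ((A / M) powr p) powr real m"
      by (simp add: powr_powr mult_ac)
    also have "\<dots> = ((A / M) powr p) ^ m"
      using A M by (intro powr_realpow) auto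
    moreover have "(C * x / \<epsilon>) powr (2 * p) = C powr (2 * p) * x powr (2 * p) * \<epsilon> powr (- 2 * p)"
      if "0 \<le> x" for x
      using that C \<epsilon> by (simp add: powr_divide powr_mult powr_minus_divide)
    ultimately show ?thesis by simp
  qed
  finally have one: "1 \<le> C powr (2 * p) * ((A / M) powr p) ^ m * \<epsilon> powr (- 2 * p)" .
  \<comment> \<open>One factor \<open>M'\<close> is bounded by linear growth, the other
    \<open>m\<close> by the ratio \<open>B\<close>. The exponential arising here and the one in
    \<open>A\<close> together make \<open>exp (2 * \<kappa>)\<close>.\<close>
  have "M' ^ Suc m \<le> (exp \<kappa> * exp \<kappa> ^ m) * (B * M) ^ m"
  proof -
    have "M' \<le> \<kappa> * real (Suc m)" by fact
    also have "\<dots> \<le> exp (\<kappa> * real (Suc m))"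
      using exp_ge_add_one_self[of "\<kappa> * real (Suc m)"] by linarith
    also have "\<dots> = exp \<kappa> * exp \<kappa> ^ m"
      by (simp add: distrib_left exp_add exp_of_nat2_mult)
    finally show ?thesis
      unfolding power_Suc using M by (intro mult_mono power_mono) auto
  qed
  then have "q ^ Suc m * M' ^ Suc m \<le> q ^ Suc m * ((exp \<kappa> * exp \<kappa> ^ m) * (B * M) ^ m)"
    using q by (intro mult_left_mono) auto
  also have "\<dots> = q * exp \<kappa> * (q * exp \<kappa> * B * M) ^ m * 1"
    by (simp add: power_mult_distrib mult_ac)
  also have "\<dots> \<le> q * exp \<kappa> * (q * exp \<kappa> * B * M) ^ m *
      (C powr (2 * p) * ((A / M) powr p) ^ m * \<epsilon> powr (- 2 * p))"
    using one q B M by (intro mult_left_mono) auto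
  also have "\<dots> = q * exp \<kappa> * C powr (2 * p) * (q * exp \<kappa> * B * M * (A / M) powr p) ^ m * \<epsilon> powr (- 2 * p)"
    by (simp add: power_mult_distrib mult_ac)
  also have "\<dots> \<le> q * exp \<kappa> * C powr (2 * p) *
      ((B * exp (2 * \<kappa>) * q * (1 + 4 * c)) powr p / M powr \<delta>) ^ m * \<epsilon> powr (- 2 * p)"
  proof -
    have "M * (A / M) powr p = A powr p / M powr \<delta>"
      using A M by (simp add: powr_divide p_def powr_add)
    then have "q * exp \<kappa> * B * M * (A / M) powr p = q * exp \<kappa> * B * (A powr p / M powr \<delta>)"
      by (simp add: mult.assoc)
    \<comment> \<open>A base of at least 1 may be raised to the power \<open>p\<close>, so that all
      constants share one exponent.\<close>
    also have "\<dots> \<le> (q * exp \<kappa> * B) powr p * (A powr p / M powr \<delta>)"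
      using powr_mono[of 1 p "q * exp \<kappa> * B"] E \<delta> by (intro mult_right_mono) (auto simp: p_def)
    also have "\<dots> = (q * exp \<kappa> * B * A) powr p / M powr \<delta>"
      using E A by (simp add: powr_mult)
    also have "q * exp \<kappa> * B * A = B * exp (2 * \<kappa>) * q * (1 + 4 * c)"
      by (simp add: A_def exp_double power2_eq_square)
    finally have "q * exp \<kappa> * B * M * (A / M) powr p
      \<le> (B * exp (2 * \<kappa>) * q * (1 + 4 * c)) powr p / M powr \<delta>" .
    then show ?thesis
      using q B M by (intro mult_right_mono mult_left_mono power_mono) auto
  qed
  finally show ?thesis by (simp add: p_def)
qed

section \<open>Error analysis of the scheme\<close>

text \<open>The recursion never mixes two values of \<open>j\<close>, so this index disappears from
  \<open>Y\<close>. The indicator in the moment hypothesis has become the premise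
  \<open>1 \<le> k\<close> of \<open>psi_bound_diff\<close>.\<close>

locale mlp = prob_space P for P :: "'w measure" +
  fixes m :: nat and c C :: real
    and y y_m1 y_0 :: "'y :: {banach, second_countable_topology}"
    and MZ :: "'z measure"
    and Z :: "int list \<Rightarrow> 'w \<Rightarrow> 'z"
    and \<psi> :: "nat \<Rightarrow> 'w \<Rightarrow>
                ('y \<Rightarrow>\<^sub>L 'h :: {real_inner, complete_space, second_countable_topology})"
    and \<Phi> :: "nat \<Rightarrow> 'y \<times> 'y \<times> 'z \<Rightarrow> 'y"
    and Y :: "int list \<Rightarrow> int \<Rightarrow> 'w \<Rightarrow> 'y"
  assumes m_pos: "1 \<le> m" and c_pos: "0 < c"
    and Z_indep: "indep_vars (\<lambda>_. MZ) Z Theta"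
    and Z_ident: "\<And>\<theta> \<theta>'. \<theta> \<in> Theta \<Longrightarrow> \<theta>' \<in> Theta \<Longrightarrow> distr P MZ (Z \<theta>) = distr P MZ (Z \<theta>')"
    and psi_meas: "\<And>k. \<psi> k \<in> measurable P strong_sigma"
    and Z_psi_indep: "indep_set (generated_sigma P Theta MZ Z) (generated_sigma P UNIV strong_sigma \<psi>)"
    and Phi_meas: "\<And>l. \<Phi> l \<in> measurable (borel \<Otimes>\<^sub>M borel \<Otimes>\<^sub>M MZ) borel"
    and Y_m1: "\<And>\<theta> \<omega>. \<theta> \<in> Theta \<Longrightarrow> \<omega> \<in> space P \<Longrightarrow> Y \<theta> (-1) \<omega> = y_m1"
    and Y_0: "\<And>\<theta> \<omega>. \<theta> \<in> Theta \<Longrightarrow> \<omega> \<in> space P \<Longrightarrow> Y \<theta> 0 \<omega> = y_0"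
    and Y_rec: "\<And>\<theta> (n::nat) \<omega>. \<theta> \<in> Theta \<Longrightarrow> n \<ge> 1 \<Longrightarrow> \<omega> \<in> space P \<Longrightarrow>
        Y \<theta> (int n) \<omega> =
          (\<Sum>l = 0..<n. (1 / real m ^ (n - l)) *\<^sub>R
             (\<Sum>i = 1..m ^ (n - l).
                \<Phi> l (Y (\<theta> @ [int l, int i]) (int l) \<omega>,
                     Y (\<theta> @ [- int l, int i]) (int l - 1) \<omega>,
                     Z (\<theta> @ [int l, int i]) \<omega>)))"
    and Phi_integrable: "\<And>k.
        (\<integral>\<^sup>+\<omega>. ennreal (norm (\<Phi> k (Y [0] (int k) \<omega>, Y [1] (int k - 1) \<omega>, Z [0] \<omega>))) \<partial>P) < \<infinity>"
    and psi_bound_Phi: "\<And>k. second_moment P (\<lambda>\<omega>. \<psi> k \<omega> (\<Phi> 0 (y_0, y_m1, Z [0] \<omega>)))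
        \<le> ennreal (C\<^sup>2 / fact k)"
    and psi_bound_diff: "\<And>k. 1 \<le> k \<Longrightarrow> second_moment P (\<lambda>\<omega>. \<psi> k \<omega> (y_0 - y)) \<le> ennreal (C\<^sup>2 / fact k)"
    and psi_Lipschitz: "\<And>k n u v. n \<ge> 1 \<Longrightarrow>
        second_moment P (\<lambda>\<omega>. \<psi> k \<omega> (\<Phi> n (u, v, Z [0] \<omega>)))
          \<le> ennreal c * second_moment P (\<lambda>\<omega>. \<psi> (k + 1) \<omega> (u - v))"
    and psi_bias: "\<And>k (n::nat). n \<ge> 1 \<Longrightarrow>
        second_moment P (\<lambda>\<omega>. \<psi> k \<omega> (y -
            (\<Sum>l = 0..<n. \<integral>\<omega>'. \<Phi> l (Y [0] (int l) \<omega>', Y [1] (int l - 1) \<omega>', Z [0] \<omega>') \<partial>P)))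
          \<le> ennreal (2 * c) * second_moment P (\<lambda>\<omega>. \<psi> (k + 1) \<omega> (Y [0] (int n - 1) \<omega> - y))"
begin

section \<open>The iterates as functionals of the random inputs\<close>

abbreviation Z_seq :: "int list set \<Rightarrow> (int list \<Rightarrow> 'z) measure" where
  "Z_seq K \<equiv> PiM K (\<lambda>_. MZ)"

text \<open>The recursion only appends to labels, so a single \<open>G\<close> serves every
  \<open>\<theta>\<close> once the inputs are read relative to \<open>\<theta>\<close>. The tails
  \<open>\<eta>\<close> are nonempty: an iterate does not read the input at its own label. The shift
  \<open>int n - 1\<close> lets the natural numbers enumerate the levels from -1 on, so
  \<open>G (Suc l)\<close> and \<open>G l\<close> belong to the levels \<open>l\<close> and
  \<open>l - 1\<close>.\<close>

lemma Y_functional: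
  "\<exists>G \<in> borel_measurable (Z_seq Theta). \<forall>\<theta>\<in>Theta. \<forall>\<omega>\<in>space P.
     Y \<theta> (int n - 1) \<omega> = G (\<lambda>\<eta>\<in>Theta. Z (\<theta> @ \<eta>) \<omega>)"
proof (induction n rule: less_induct)
  case (less n)
  consider "n = 0" | "n = 1" | N where "1 \<le> N" "n = Suc N"
    by (cases n; cases "n - 1") auto
  then show ?case
  proof cases
    case 1
    then show ?thesis using Y_m1 by (intro bexI[of _ "\<lambda>_. y_m1"]) auto
  next
    case 2
    then show ?thesis using Y_0 by (intro bexI[of _ "\<lambda>_. y_0"]) auto
  next
    case 3
    obtain G where G: "\<And>r. r < n \<Longrightarrow> G r \<in> borel_measurable (Z_seq Theta)"
      and YG: "\<And>r \<theta> \<omega>. r < n \<Longrightarrow> \<theta> \<in> Theta \<Longrightarrow> \<omega> \<in> space P \<Longrightarrow>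
          Y \<theta> (int r - 1) \<omega> = G r (\<lambda>\<eta>\<in>Theta. Z (\<theta> @ \<eta>) \<omega>)"
    proof -
      have "\<forall>r\<in>{..<n}. \<exists>G. G \<in> borel_measurable (Z_seq Theta) \<and> (\<forall>\<theta>\<in>Theta. \<forall>\<omega>\<in>space P.
          Y \<theta> (int r - 1) \<omega> = G (\<lambda>\<eta>\<in>Theta. Z (\<theta> @ \<eta>) \<omega>))"
        using less by blast
      from bchoice[OF this] that show thesis by blast
    qed
    define G' where "G' = (\<lambda>w. \<Sum>l = 0..<N. (1 / real m ^ (N - l)) *\<^sub>R (\<Sum>i = 1..m ^ (N - l).
        \<Phi> l (G (Suc l) (\<lambda>\<eta>\<in>Theta. w ([int l, int i] @ \<eta>)), G l (\<lambda>\<eta>\<in>Theta. w ([- int l, int i] @ \<eta>)),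
            w [int l, int i])))"
    have shift: "(\<lambda>w. \<lambda>\<eta>\<in>Theta. w (a @ \<eta>)) \<in> measurable (Z_seq Theta) (Z_seq Theta)" for a
      by (intro measurable_restrict measurable_component_singleton) (auto simp: Theta_iff)
    have "G' \<in> borel_measurable (Z_seq Theta)"
      unfolding G'_def using 3
      by (intro borel_measurable_sum borel_measurable_scaleR borel_measurable_const
          measurable_compose[OF _ Phi_meas] measurable_Pair measurable_compose[OF shift G]
          measurable_component_singleton) (auto simp: Theta_iff)
    moreover have "Y \<theta> (int n - 1) \<omega> = G' (\<lambda>\<eta>\<in>Theta. Z (\<theta> @ \<eta>) \<omega>)"
      if "\<theta> \<in> Theta" "\<omega> \<in> space P" for \<theta> \<omega>
    proof -
      have a: "Y (\<theta> @ [i, j]) (int l) \<omega>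
          = G (Suc l) (\<lambda>\<eta>\<in>Theta. (\<lambda>\<eta>\<in>Theta. Z (\<theta> @ \<eta>) \<omega>) ([i, j] @ \<eta>))" if "l < N" for l i j
        using YG[of "Suc l" "\<theta> @ [i, j]" \<omega>] that \<open>\<omega> \<in> space P\<close> 3
        by (simp add: Theta_iff cong: restrict_cong)
      have b: "Y (\<theta> @ [i, j]) (int l - 1) \<omega>
          = G l (\<lambda>\<eta>\<in>Theta. (\<lambda>\<eta>\<in>Theta. Z (\<theta> @ \<eta>) \<omega>) ([i, j] @ \<eta>))" if "l < N" for l i j
        using YG[of l "\<theta> @ [i, j]" \<omega>] that \<open>\<omega> \<in> space P\<close> 3
        by (simp add: Theta_iff cong: restrict_cong)
      have "Y \<theta> (int n - 1) \<omega> = Y \<theta> (int N) \<omega>" using 3 by simp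
      also have "\<dots> = G' (\<lambda>\<eta>\<in>Theta. Z (\<theta> @ \<eta>) \<omega>)"
        unfolding G'_def Y_rec[OF that(1) 3(1) that(2)]
        by (intro sum.cong refl arg_cong2[where f = scaleR]) (simp add: a b Theta_iff)
      finally show ?thesis .
    qed
    ultimately show ?thesis by blast
  qed
qed

definition Y_fun :: "nat \<Rightarrow> (int list \<Rightarrow> 'z) \<Rightarrow> 'y" where
  "Y_fun n = (SOME G. G \<in> borel_measurable (Z_seq Theta) \<and> (\<forall>\<theta>\<in>Theta. \<forall>\<omega>\<in>space P.
     Y \<theta> (int n - 1) \<omega> = G (\<lambda>\<eta>\<in>Theta. Z (\<theta> @ \<eta>) \<omega>)))"

lemma Y_fun_measurable: "Y_fun n \<in> borel_measurable (Z_seq Theta)"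
  and Y_eq_Y_fun: "\<theta> \<in> Theta \<Longrightarrow> \<omega> \<in> space P \<Longrightarrow>
    Y \<theta> (int n - 1) \<omega> = Y_fun n (\<lambda>\<eta>\<in>Theta. Z (\<theta> @ \<eta>) \<omega>)"
proof -
  have "\<exists>G. G \<in> borel_measurable (Z_seq Theta) \<and> (\<forall>\<theta>\<in>Theta. \<forall>\<omega>\<in>space P.
     Y \<theta> (int n - 1) \<omega> = G (\<lambda>\<eta>\<in>Theta. Z (\<theta> @ \<eta>) \<omega>))"
    using Y_functional[of n] by blast
  from someI_ex[OF this, folded Y_fun_def] show "Y_fun n \<in> borel_measurable (Z_seq Theta)"
    "\<theta> \<in> Theta \<Longrightarrow> \<omega> \<in> space P \<Longrightarrow>
      Y \<theta> (int n - 1) \<omega> = Y_fun n (\<lambda>\<eta>\<in>Theta. Z (\<theta> @ \<eta>) \<omega>)" by auto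
qed

text \<open>Measurability with respect to \<open>Z_alg\<close> records that a random variable is
  determined by the inputs and hence independent of \<open>\<psi>\<close>.\<close>

definition Z_alg :: "'w measure" where
  "Z_alg = sigma (space P) (\<Union>\<theta>\<in>Theta. {Z \<theta> -` A \<inter> space P |A. A \<in> sets MZ})"

lemma Z_rv: "\<theta> \<in> Theta \<Longrightarrow> Z \<theta> \<in> measurable P MZ"
  using Z_indep by (auto simp: indep_vars_def)

lemma space_Z_alg[simp]: "space Z_alg = space P"
  by (simp add: Z_alg_def space_measure_of_conv)

lemma sets_Z_alg: "sets Z_alg = generated_sigma P Theta MZ Z"
  unfolding Z_alg_def generated_sigma_def by (rule sets_measure_of) auto

lemma Z_measurable_alg: "\<theta> \<in> Theta \<Longrightarrow> Z \<theta> \<in> measurable Z_alg MZ"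
  using measurable_space[OF Z_rv]
  by (intro measurableI) (auto simp: sets_Z_alg generated_sigma_def intro!: sigma_sets.Basic)

lemma measurable_Z_alg_imp: "X \<in> measurable Z_alg L \<Longrightarrow> X \<in> measurable P L"
proof -
  have "sets Z_alg \<subseteq> sets P"
    unfolding sets_Z_alg generated_sigma_def
    using Z_rv by (intro sets.sigma_sets_subset) (auto intro: measurable_sets)
  then show "X \<in> measurable Z_alg L \<Longrightarrow> X \<in> measurable P L"
    by (auto simp: measurable_def)
qed

lemma Y_measurable_alg:
  assumes "\<theta> \<in> Theta" shows "Y \<theta> (int n - 1) \<in> borel_measurable Z_alg"
proof -
  have "(\<lambda>\<omega>. Y_fun n (\<lambda>\<eta>\<in>Theta. Z (\<theta> @ \<eta>) \<omega>)) \<in> borel_measurable Z_alg"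
    using assms
    by (intro measurable_compose[OF _ Y_fun_measurable] measurable_restrict Z_measurable_alg)
      (auto simp: Theta_iff)
  then show ?thesis
    using Y_eq_Y_fun[OF assms] by (subst measurable_cong) auto
qed

lemma Y_measurable_alg':
  assumes "\<theta> \<in> Theta" shows "Y \<theta> (int n) \<in> borel_measurable Z_alg"
  using Y_measurable_alg[OF assms, of "Suc n"] by simp

lemma psi_indep:
  assumes X: "X \<in> measurable Z_alg L"
  shows "indep_set {\<psi> k -` a \<inter> space P |a. a \<in> sets strong_sigma} {X -` b \<inter> space P |b. b \<in> sets L}"
proof -
  have "{X -` b \<inter> space P |b. b \<in> sets L} \<subseteq> generated_sigma P Theta MZ Z"
    using measurable_sets[OF X] by (auto simp flip: sets_Z_alg)
  moreover have "{\<psi> k -` a \<inter> space P |a. a \<in> sets strong_sigma} \<subseteq> generated_sigma P UNIV strong_sigma \<psi>"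
    unfolding generated_sigma_def by (auto intro!: sigma_sets.Basic)
  ultimately show ?thesis
    using Z_psi_indep unfolding indep_sets2_eq
    by (intro conjI ballI) (blast, blast, subst Int_commute, subst mult.commute, blast)
qed

text \<open>Freezing the operator: by independence, operator and argument may be sampled separately.
  For each fixed \<open>\<omega>\<close> the inner moment concerns a deterministic operator. Read
  from right to left, the identity releases the operator again.\<close>

lemma second_moment_psi:
  assumes X: "X \<in> borel_measurable Z_alg"
  shows "second_moment P (\<lambda>\<omega>. \<psi> k \<omega> (X \<omega>)) = (\<integral>\<^sup>+\<omega>. second_moment P (\<lambda>\<omega>'. \<psi> k \<omega> (X \<omega>')) \<partial>P)"
proof -
  have "(\<lambda>p. blinfun_apply (fst p) (snd p)) \<in> borel_measurable ((strong_sigma :: ('y \<Rightarrow>\<^sub>L 'h) measure) \<Otimes>\<^sub>M borel)"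
    by (intro measurable_blinfun_apply_strong_sigma) auto
  then have "(\<lambda>p. ennreal ((norm (blinfun_apply (fst p) (snd p)))\<^sup>2))
      \<in> borel_measurable ((strong_sigma :: ('y \<Rightarrow>\<^sub>L 'h) measure) \<Otimes>\<^sub>M borel)" by measurable
  from nn_integral_indep_Fubini[OF psi_meas measurable_Z_alg_imp[OF X] psi_indep[OF X] this, of k] show ?thesis
    by (simp add: second_moment_def)
qed

section \<open>Laws and independence of the summands\<close>

abbreviation Phi0 :: "nat \<Rightarrow> 'w \<Rightarrow> 'y" where
  "Phi0 l \<omega> \<equiv> \<Phi> l (Y [0] (int l) \<omega>, Y [1] (int l - 1) \<omega>, Z [0] \<omega>)"

lemma Y_fun_shift_measurable:
  assumes "\<And>\<eta>. \<eta> \<in> Theta \<Longrightarrow> \<theta> @ \<eta> \<in> K"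
  shows "(\<lambda>w. Y_fun n (\<lambda>\<eta>\<in>Theta. w (\<theta> @ \<eta>))) \<in> borel_measurable (Z_seq K)"
  using assms
  by (intro measurable_compose[OF _ Y_fun_measurable] measurable_restrict
      measurable_component_singleton)

lemma Y_measurable:
  assumes "\<theta> \<in> Theta"
  shows "Y \<theta> (int n) \<in> borel_measurable P" "Y \<theta> (int n - 1) \<in> borel_measurable P"
  using Y_measurable_alg[OF assms] Y_measurable_alg'[OF assms] by (auto intro: measurable_Z_alg_imp)

lemma Phi_measurable_alg:
  assumes "\<theta>1 \<in> Theta" "\<theta>2 \<in> Theta" "\<theta>3 \<in> Theta"
  shows "(\<lambda>\<omega>. \<Phi> l (Y \<theta>1 (int l) \<omega>, Y \<theta>2 (int l - 1) \<omega>, Z \<theta>3 \<omega>)) \<in> borel_measurable Z_alg"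
  using assms
  by (intro measurable_compose[OF _ Phi_meas] measurable_Pair Y_measurable_alg Y_measurable_alg'
      Z_measurable_alg)

lemma Y_distr:
  assumes "\<theta> \<in> Theta" "\<theta>' \<in> Theta"
  shows "distr P borel (Y \<theta> (int n - 1)) = distr P borel (Y \<theta>' (int n - 1))"
proof -
  have "distr P borel (\<lambda>\<omega>. Y_fun n (\<lambda>\<eta>\<in>Theta. Z (\<theta> @ \<eta>) \<omega>))
      = distr P borel (\<lambda>\<omega>. Y_fun n (\<lambda>\<eta>\<in>Theta. Z (\<theta>' @ \<eta>) \<omega>))"
    by (rule distr_iid_reindex[OF Z_indep Z_ident]) (auto simp: inj_on_def Theta_iff Y_fun_measurable)
  then show ?thesis
    using assms by (simp add: Y_eq_Y_fun cong: distr_cong)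
qed

text \<open>\<open>S\<close> collects the labels of all inputs that \<open>Phi0 l\<close> reads. The
  relabelling \<open>\<sigma>\<close> replaces the head 0 or 1 by the corresponding prefix and keeps
  the tail; being injective, it does not change the joint law.\<close>

lemma Phi_distr:
  assumes \<theta>: "\<theta> \<in> Theta"
  shows "distr P borel (\<lambda>\<omega>. \<Phi> l (Y (\<theta> @ [int l, i]) (int l) \<omega>, Y (\<theta> @ [- int l, i]) (int l - 1) \<omega>,
      Z (\<theta> @ [int l, i]) \<omega>)) = distr P borel (Phi0 l)"
proof -
  define S :: "int list set" where "S = {[0]} \<union> (#) 0 ` Theta \<union> (#) 1 ` Theta"
  \<comment> \<open>For \<open>l = 0\<close> the labels \<open>l\<close> and \<open>- l\<close> coincide, but then the second argument of \<open>\<Phi>\<close> is a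
    constant and its label can be changed at will.\<close>
  define b where "b = (if l = 0 then - 1 else - int l)"
  define \<sigma> where "\<sigma> = (\<lambda>s. \<theta> @ [if hd s = 0 then int l else b, i] @ tl s)"
  define h where "h = (\<lambda>w. \<Phi> l (Y_fun (Suc l) (\<lambda>\<eta>\<in>Theta. w ([0] @ \<eta>)),
      Y_fun l (\<lambda>\<eta>\<in>Theta. w ([1] @ \<eta>)), w [0]))"
  have mem: "[0] @ \<eta> \<in> S" "[1] @ \<eta> \<in> S" if "\<eta> \<in> Theta" for \<eta>
    using that by (auto simp: S_def)
  have h: "h \<in> borel_measurable (Z_seq S)"
    unfolding h_def
    by (intro measurable_compose[OF _ Phi_meas] measurable_Pair Y_fun_shift_measurable mem
        measurable_component_singleton) (auto simp: S_def)
  have "distr P borel (\<lambda>\<omega>. h (\<lambda>s\<in>S. Z (\<sigma> s) \<omega>)) = distr P borel (\<lambda>\<omega>. h (\<lambda>s\<in>S. Z s \<omega>))"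
  proof (rule distr_iid_reindex[OF Z_indep Z_ident _ _ _ _ h])
    have "int l \<noteq> b" by (simp add: b_def)
    then show "inj_on \<sigma> S"
      by (auto simp: inj_on_def \<sigma>_def S_def split: if_splits)
    show "\<sigma> ` S \<subseteq> Theta" by (auto simp: \<sigma>_def Theta_iff)
    show "(\<lambda>s. s) ` S \<subseteq> Theta" by (auto simp: S_def Theta_iff)
  qed auto
  moreover have "h (\<lambda>s\<in>S. Z s \<omega>) = Phi0 l \<omega>" if "\<omega> \<in> space P" for \<omega>
    using Y_eq_Y_fun[OF _ that, of "[0]" "Suc l"] Y_eq_Y_fun[OF _ that, of "[1]" l]
    by (simp add: h_def Theta_iff S_def cong: restrict_cong)
  moreover have "h (\<lambda>s\<in>S. Z (\<sigma> s) \<omega>) = \<Phi> l (Y (\<theta> @ [int l, i]) (int l) \<omega>,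
      Y (\<theta> @ [- int l, i]) (int l - 1) \<omega>, Z (\<theta> @ [int l, i]) \<omega>)" if "\<omega> \<in> space P" for \<omega>
  proof -
    have "Y (\<theta> @ [- int l, i]) (int l - 1) \<omega> = Y (\<theta> @ [b, i]) (int l - 1) \<omega>"
      using Y_m1 that by (simp add: b_def Theta_iff)
    then show ?thesis
      using Y_eq_Y_fun[OF _ that, of "\<theta> @ [int l, i]" "Suc l"] Y_eq_Y_fun[OF _ that, of "\<theta> @ [b, i]" l]
      by (simp add: h_def Theta_iff S_def \<sigma>_def cong: restrict_cong)
  qed
  ultimately show ?thesis
    by (simp cong: distr_cong)
qed

text \<open>Both iterates read only inputs with labels in \<open>K\<close>, all of length at least
  two. So \<open>Z [0]\<close> is independent of them, and they can be frozen.\<close>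

lemma second_moment_Phi0_Fubini:
  fixes \<phi> :: "'y \<Rightarrow>\<^sub>L 'h"
  shows "second_moment P (\<lambda>\<omega>. \<phi> (Phi0 l \<omega>)) =
    (\<integral>\<^sup>+\<omega>. second_moment P (\<lambda>\<omega>'. \<phi> (\<Phi> l (Y [0] (int l) \<omega>, Y [1] (int l - 1) \<omega>, Z [0] \<omega>'))) \<partial>P)"
proof -
  define K :: "int list set" where "K = (#) 0 ` Theta \<union> (#) 1 ` Theta"
  define u where "u = (\<lambda>w. (Y_fun (Suc l) (\<lambda>\<eta>\<in>Theta. w ([0] @ \<eta>)), Y_fun l (\<lambda>\<eta>\<in>Theta. w ([1] @ \<eta>))))"
  define f where "f = (\<lambda>p. ennreal ((norm (\<phi> (\<Phi> l (fst (u (fst p)), snd (u (fst p)), snd p [0 :: int]))))\<^sup>2))"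
  have mem: "[0] @ \<eta> \<in> K" "[1] @ \<eta> \<in> K" if "\<eta> \<in> Theta" for \<eta>
    using that by (auto simp: K_def)
  have u: "u \<in> measurable (Z_seq K) (borel \<Otimes>\<^sub>M borel)"
    unfolding u_def by (intro measurable_Pair Y_fun_shift_measurable mem)
  have u': "(\<lambda>p. u (fst p)) \<in> measurable (Z_seq K \<Otimes>\<^sub>M Z_seq {[0]}) (borel \<Otimes>\<^sub>M borel)"
    by (rule measurable_compose[OF measurable_fst u])
  have comp: "(\<lambda>w. w [0]) \<in> measurable (Z_seq {[0]}) MZ"
    by (rule measurable_component_singleton) simp
  have "(\<lambda>p. (fst (u (fst p)), snd (u (fst p)), snd p [0])) \<in> measurable (Z_seq K \<Otimes>\<^sub>M Z_seq {[0]}) (borel \<Otimes>\<^sub>M borel \<Otimes>\<^sub>M MZ)"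
    by (intro measurable_Pair measurable_compose[OF u' measurable_fst]
        measurable_compose[OF u' measurable_snd] measurable_compose[OF measurable_snd comp])
  from measurable_compose[OF this Phi_meas]
  have m: "(\<lambda>p. \<Phi> l (fst (u (fst p)), snd (u (fst p)), snd p [0])) \<in> borel_measurable (Z_seq K \<Otimes>\<^sub>M Z_seq {[0]})" .
  have "(\<lambda>x. ennreal ((norm (\<phi> x))\<^sup>2)) \<in> borel_measurable borel"
    by (intro measurable_compose[OF _ measurable_ennreal] borel_measurable_continuous_onI continuous_intros)
  from measurable_compose[OF m this] have f: "f \<in> borel_measurable (Z_seq K \<Otimes>\<^sub>M Z_seq {[0]})"
    by (simp add: f_def)
  have ind: "indep_var (Z_seq K) (\<lambda>\<omega>. \<lambda>\<theta>\<in>K. Z \<theta> \<omega>) (Z_seq {[0]}) (\<lambda>\<omega>. \<lambda>\<theta>\<in>{[0]}. Z \<theta> \<omega>)"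
    by (rule indep_var_restrict[OF Z_indep]) (auto simp: K_def Theta_iff)
  have u_eq: "u (\<lambda>\<theta>\<in>K. Z \<theta> \<omega>) = (Y [0] (int l) \<omega>, Y [1] (int l - 1) \<omega>)" if "\<omega> \<in> space P" for \<omega>
    using Y_eq_Y_fun[OF _ that, of "[0]" "Suc l"] Y_eq_Y_fun[OF _ that, of "[1]" l]
    by (simp add: u_def Theta_iff K_def cong: restrict_cong)
  have "second_moment P (\<lambda>\<omega>. \<phi> (Phi0 l \<omega>))
      = (\<integral>\<^sup>+\<omega>. f (\<lambda>\<theta>\<in>K. Z \<theta> \<omega>, \<lambda>\<theta>\<in>{[0]}. Z \<theta> \<omega>) \<partial>P)"
    unfolding second_moment_def by (intro nn_integral_cong) (simp add: f_def u_eq)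
  also have "\<dots> = (\<integral>\<^sup>+\<omega>. \<integral>\<^sup>+\<omega>'. f (\<lambda>\<theta>\<in>K. Z \<theta> \<omega>, \<lambda>\<theta>\<in>{[0]}. Z \<theta> \<omega>') \<partial>P \<partial>P)"
    by (rule indep_var_nn_integral_Fubini[OF ind f])
  also have "\<dots> = (\<integral>\<^sup>+\<omega>. second_moment P (\<lambda>\<omega>'. \<phi> (\<Phi> l (Y [0] (int l) \<omega>, Y [1] (int l - 1) \<omega>, Z [0] \<omega>'))) \<partial>P)"
    unfolding second_moment_def by (intro nn_integral_cong) (simp add: f_def u_eq)
  finally show ?thesis .
qed

lemma second_moment_psi_measurable:
  fixes g :: "'v \<Rightarrow> 'w \<Rightarrow> 'y"
  assumes g: "(\<lambda>(x, \<omega>). g x \<omega>) \<in> borel_measurable (N \<Otimes>\<^sub>M P)"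
  shows "(\<lambda>(\<omega>, x). second_moment P (\<lambda>\<omega>'. \<psi> k \<omega> (g x \<omega>'))) \<in> borel_measurable (P \<Otimes>\<^sub>M N)"
proof -
  have "(\<lambda>q. (snd (fst q), snd q)) \<in> measurable ((P \<Otimes>\<^sub>M N) \<Otimes>\<^sub>M P) (N \<Otimes>\<^sub>M P)"
    by measurable
  from measurable_compose[OF this g]
  have g': "(\<lambda>q. g (snd (fst q)) (snd q)) \<in> borel_measurable ((P \<Otimes>\<^sub>M N) \<Otimes>\<^sub>M P)"
    by simp
  have "(\<lambda>q. \<psi> k (fst (fst q))) \<in> measurable ((P \<Otimes>\<^sub>M N) \<Otimes>\<^sub>M P) strong_sigma"
    by (rule measurable_compose[OF _ psi_meas]) measurable
  from measurable_blinfun_apply_strong_sigma[OF this g']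
  have "(\<lambda>(p, \<omega>'). ennreal ((norm (\<psi> k (fst p) (g (snd p) \<omega>')))\<^sup>2)) \<in> borel_measurable ((P \<Otimes>\<^sub>M N) \<Otimes>\<^sub>M P)"
    by (simp add: split_beta')
  from borel_measurable_nn_integral[OF this] show ?thesis
    by (simp add: second_moment_def split_beta')
qed

lemma second_moment_psi_measurable':
  assumes "X \<in> borel_measurable P"
  shows "(\<lambda>\<omega>. second_moment P (\<lambda>\<omega>'. \<psi> k \<omega> (X \<omega>'))) \<in> borel_measurable P"
proof -
  have "(\<lambda>(x, \<omega>). X \<omega>) \<in> borel_measurable (P \<Otimes>\<^sub>M P)"
    using assms by simp
  from second_moment_psi_measurable[OF this, of k]
  have *: "(\<lambda>p. second_moment P (\<lambda>\<omega>'. \<psi> k (fst p) (X \<omega>'))) \<in> borel_measurable (P \<Otimes>\<^sub>M P)"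
    by (simp add: split_beta')
  have "(\<lambda>\<omega>. (\<omega>, \<omega>)) \<in> measurable P (P \<Otimes>\<^sub>M P)" by measurable
  from measurable_compose[OF this *] show ?thesis by simp
qed

text \<open>\<open>psi_Lipschitz\<close> needs deterministic \<open>u\<close> and \<open>v\<close>
  but a random operator. Hence operator and iterates are frozen, the integrals exchanged, and the
  operator released while the iterates stay frozen. After the hypothesis has been applied,
  exchanging the integrals once more leads back.\<close>

lemma second_moment_psi_Phi0_le:
  assumes l: "1 \<le> l"
  shows "second_moment P (\<lambda>\<omega>. \<psi> k \<omega> (Phi0 l \<omega>))
    \<le> ennreal c * second_moment P (\<lambda>\<omega>. \<psi> (k + 1) \<omega> (Y [0] (int l) \<omega> - Y [1] (int l - 1) \<omega>))"
proof -
  interpret PP: pair_sigma_finite P P ..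
  let ?u = "Y [0] (int l)" and ?v = "Y [1] (int l - 1)"
  have T: "[0] \<in> Theta" "[1] \<in> Theta" by (auto simp: Theta_iff)
  note mu = Y_measurable(1)[OF T(1), of l] and mv = Y_measurable(2)[OF T(2), of l]
  have m1: "(\<lambda>(\<omega>'', \<omega>'). \<Phi> l (?u \<omega>'', ?v \<omega>'', Z [0] \<omega>')) \<in> borel_measurable (P \<Otimes>\<^sub>M P)"
    unfolding split_beta'
    by (intro measurable_compose[OF _ Phi_meas] measurable_Pair measurable_compose[OF measurable_fst mu]
        measurable_compose[OF measurable_fst mv] measurable_compose[OF measurable_snd Z_rv[OF T(1)]])
  have "(\<lambda>p. \<psi> (k + 1) (fst p)) \<in> measurable (P \<Otimes>\<^sub>M P) strong_sigma"
    by (rule measurable_compose[OF measurable_fst psi_meas])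
  moreover have uv: "(\<lambda>\<omega>. ?u \<omega> - ?v \<omega>) \<in> borel_measurable P"
    using mu mv by (rule borel_measurable_diff)
  ultimately have "(\<lambda>p. \<psi> (k + 1) (fst p) (?u (snd p) - ?v (snd p))) \<in> borel_measurable (P \<Otimes>\<^sub>M P)"
    by (intro measurable_blinfun_apply_strong_sigma measurable_compose[OF measurable_snd uv])
  then have m2: "(\<lambda>(\<omega>, \<omega>''). ennreal ((norm (\<psi> (k + 1) \<omega> (?u \<omega>'' - ?v \<omega>'')))\<^sup>2))
      \<in> borel_measurable (P \<Otimes>\<^sub>M P)"
    by (simp add: split_beta')
  from PP.Fubini'[OF m2] have swap: "(\<integral>\<^sup>+\<omega>''. second_moment P (\<lambda>\<omega>. \<psi> (k + 1) \<omega> (?u \<omega>'' - ?v \<omega>'')) \<partial>P)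
      = (\<integral>\<^sup>+\<omega>. second_moment P (\<lambda>\<omega>''. \<psi> (k + 1) \<omega> (?u \<omega>'' - ?v \<omega>'')) \<partial>P)"
    by (simp add: second_moment_def)
  have "(\<lambda>(\<omega>'', \<omega>). ennreal ((norm (\<psi> (k + 1) \<omega> (?u \<omega>'' - ?v \<omega>'')))\<^sup>2)) \<in> borel_measurable (P \<Otimes>\<^sub>M P)"
    using measurable_pair_swap[OF m2] by (simp add: split_beta')
  from borel_measurable_nn_integral[OF this]
  have m3: "(\<lambda>\<omega>''. second_moment P (\<lambda>\<omega>. \<psi> (k + 1) \<omega> (?u \<omega>'' - ?v \<omega>''))) \<in> borel_measurable P"
    by (simp add: second_moment_def)
  have "second_moment P (\<lambda>\<omega>. \<psi> k \<omega> (Phi0 l \<omega>))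
      = (\<integral>\<^sup>+\<omega>. \<integral>\<^sup>+\<omega>''. second_moment P (\<lambda>\<omega>'. \<psi> k \<omega> (\<Phi> l (?u \<omega>'', ?v \<omega>'', Z [0] \<omega>'))) \<partial>P \<partial>P)"
    using T by (simp add: second_moment_psi Phi_measurable_alg second_moment_Phi0_Fubini)
  also have "\<dots> = (\<integral>\<^sup>+\<omega>''. \<integral>\<^sup>+\<omega>. second_moment P (\<lambda>\<omega>'. \<psi> k \<omega> (\<Phi> l (?u \<omega>'', ?v \<omega>'', Z [0] \<omega>'))) \<partial>P \<partial>P)"
    by (rule PP.Fubini'[symmetric]) (rule second_moment_psi_measurable[OF m1])
  also have "\<dots> = (\<integral>\<^sup>+\<omega>''. second_moment P (\<lambda>\<omega>. \<psi> k \<omega> (\<Phi> l (?u \<omega>'', ?v \<omega>'', Z [0] \<omega>))) \<partial>P)"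
  proof (intro nn_integral_cong)
    fix \<omega>''
    have "(\<lambda>\<omega>. \<Phi> l (?u \<omega>'', ?v \<omega>'', Z [0] \<omega>)) \<in> borel_measurable Z_alg"
      by (intro measurable_compose[OF _ Phi_meas] measurable_Pair measurable_const
          Z_measurable_alg[OF T(1)]) auto
    from second_moment_psi[OF this, of k]
    show "(\<integral>\<^sup>+\<omega>. second_moment P (\<lambda>\<omega>'. \<psi> k \<omega> (\<Phi> l (?u \<omega>'', ?v \<omega>'', Z [0] \<omega>'))) \<partial>P)
        = second_moment P (\<lambda>\<omega>. \<psi> k \<omega> (\<Phi> l (?u \<omega>'', ?v \<omega>'', Z [0] \<omega>)))" by simp
  qed
  also have "\<dots> \<le> (\<integral>\<^sup>+\<omega>''. ennreal c * second_moment P (\<lambda>\<omega>. \<psi> (k + 1) \<omega> (?u \<omega>'' - ?v \<omega>'')) \<partial>P)"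
    by (intro nn_integral_mono psi_Lipschitz[OF l])
  also have "\<dots> = ennreal c * second_moment P (\<lambda>\<omega>. \<psi> (k + 1) \<omega> (?u \<omega> - ?v \<omega>))"
    unfolding nn_integral_cmult[OF m3] swap
    by (subst second_moment_psi[symmetric])
      (auto intro: borel_measurable_diff Y_measurable_alg Y_measurable_alg' T)
  finally show ?thesis .
qed

section \<open>Variance and bias of one iterate\<close>

lemma Phi0_integrable: "integrable P (Phi0 l)"
  using Phi_integrable[of l] Phi_measurable_alg[THEN measurable_Z_alg_imp, of "[0]" "[1]" "[0]" l]
  by (intro integrableI_bounded) (auto simp: Theta_iff)

text \<open>Summands with different \<open>(l, i)\<close> read inputs below different prefixes,
  hence are independent. Each has the law of \<open>Phi0 l\<close> scaled by the inverse of the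
  sample size; the scaling enters squared and the number of copies once, so one factor of the
  inverse survives.\<close>

lemma second_moment_Y_le:
  fixes \<phi> :: "'y \<Rightarrow>\<^sub>L 'h"
  assumes n: "1 \<le> n"
  shows "second_moment P (\<lambda>\<omega>. \<phi> (Y [0] (int n) \<omega> - y))
    \<le> (\<Sum>l = 0..<n. ennreal (1 / real m ^ (n - l)) * second_moment P (\<lambda>\<omega>. \<phi> (Phi0 l \<omega>)))
      + ennreal ((norm (\<phi> (y - (\<Sum>l = 0..<n. \<integral>\<omega>. Phi0 l \<omega> \<partial>P))))\<^sup>2)"
proof -
  define I where "I = (SIGMA l:{0..<n}. {1..m ^ (n - l)})"
  define a where "a = (\<lambda>l. 1 / real m ^ (n - l))"
  \<comment> \<open>The empty tail is included because the summand also reads the input at its own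
    label. For \<open>l = 0\<close> both ranges coincide, which is harmless since independence is
    only required between different summands.\<close>
  define K :: "nat \<times> nat \<Rightarrow> int list set"
    where "K = (\<lambda>(l, i). range ((@) [0, int l, int i]) \<union> range ((@) [0, - int l, int i]))"
  define t where "t = (\<lambda>(l, i) w. a l *\<^sub>R \<Phi> l (Y_fun (Suc l) (\<lambda>\<eta>\<in>Theta. w ([0, int l, int i] @ \<eta>)),
      Y_fun l (\<lambda>\<eta>\<in>Theta. w ([0, - int l, int i] @ \<eta>)), w [0, int l, int i]))"
  define T where "T = (\<lambda>l i \<omega>. \<Phi> l (Y ([0] @ [int l, int i]) (int l) \<omega>,
      Y ([0] @ [- int l, int i]) (int l - 1) \<omega>, Z ([0] @ [int l, int i]) \<omega>))"
  define X where "X = (\<lambda>p \<omega>. t p (\<lambda>\<theta>\<in>K p. Z \<theta> \<omega>))"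
  have fin: "finite I" by (simp add: I_def)
  have mp: "0 < real m" using m_pos by simp
  have inK: "[0, int l, int i] \<in> K (l, i)" for l i
    by (auto simp: K_def intro: rangeI[of "(@) [0, int l, int i]" "[]", simplified])
  have t: "t p \<in> borel_measurable (Z_seq (K p))" for p
  proof (cases p)
    case (Pair l i)
    show ?thesis
      unfolding t_def Pair case_prod_conv
      by (intro borel_measurable_scaleR borel_measurable_const measurable_compose[OF _ Phi_meas]
          measurable_Pair Y_fun_shift_measurable measurable_component_singleton inK)
        (auto simp: K_def)
  qed
  \<comment> \<open>Opposite signs cause no clash: \<open>int l = - int l'\<close> forces both to be
    0.\<close>
  have "disjoint_family_on K I"
    by (auto simp: disjoint_family_on_def K_def I_def)
  then have "indep_vars (\<lambda>p. Z_seq (K p)) (\<lambda>p \<omega>. \<lambda>\<theta>\<in>K p. Z \<theta> \<omega>) I"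
    by (intro indep_vars_restrict[OF Z_indep]) (auto simp: K_def Theta_iff)
  from indep_vars_compose2[OF this t] have ind: "indep_vars (\<lambda>_. borel) X I"
    by (simp add: X_def)
  have X_eq: "X (l, i) \<omega> = a l *\<^sub>R T l i \<omega>" if "\<omega> \<in> space P" for l i \<omega>
    using Y_eq_Y_fun[OF _ that, of "[0, int l, int i]" "Suc l"]
      Y_eq_Y_fun[OF _ that, of "[0, - int l, int i]" l] inK[of l i]
    by (simp add: X_def t_def T_def Theta_iff K_def cong: restrict_cong)
  have T_meas: "T l i \<in> borel_measurable P" for l i
    unfolding T_def by (intro measurable_Z_alg_imp[OF Phi_measurable_alg]) (auto simp: Theta_iff)
  have Phi0_meas: "Phi0 l \<in> borel_measurable P" for l
    using Phi0_integrable by auto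
  have T_distr: "distr P borel (T l i) = distr P borel (Phi0 l)" for l i
    unfolding T_def by (rule Phi_distr) (simp add: Theta_iff)
  have "integrable P (T l i) \<longleftrightarrow> integrable P (Phi0 l)" for l i
    using integrable_distr_eq[OF T_meas, of "\<lambda>x. x"] integrable_distr_eq[OF Phi0_meas, of "\<lambda>x. x"]
    by (simp add: T_distr)
  then have T_int: "integrable P (T l i)" for l i using Phi0_integrable by simp
  have T_expect: "(\<integral>\<omega>. T l i \<omega> \<partial>P) = (\<integral>\<omega>. Phi0 l \<omega> \<partial>P)" for l i
    using integral_distr[OF T_meas, of "\<lambda>x. x"] integral_distr[OF Phi0_meas, of "\<lambda>x. x"]
    by (simp add: T_distr)
  have X_int: "integrable P (X p)" for p
  proof (cases p)
    case (Pair l i)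
    have "integrable P (\<lambda>\<omega>. a l *\<^sub>R T l i \<omega>)" using T_int by simp
    then show ?thesis
      unfolding Pair by (rule Bochner_Integration.integrable_cong[THEN iffD1, rotated 2])
        (simp_all add: X_eq)
  qed
  have X_expect: "(\<integral>\<omega>. X (l, i) \<omega> \<partial>P) = a l *\<^sub>R (\<integral>\<omega>. Phi0 l \<omega> \<partial>P)" for l i
  proof -
    have "(\<integral>\<omega>. X (l, i) \<omega> \<partial>P) = (\<integral>\<omega>. a l *\<^sub>R T l i \<omega> \<partial>P)"
      by (intro Bochner_Integration.integral_cong) (simp_all add: X_eq)
    then show ?thesis by (simp add: T_expect)
  qed
  have bphi: "blinfun_apply \<phi> \<in> borel_measurable borel"
    by (intro borel_measurable_continuous_onI continuous_intros)
  have X_sm: "second_moment P (\<lambda>\<omega>. \<phi> (X (l, i) \<omega>)) = ennreal ((a l)\<^sup>2) * second_moment P (\<lambda>\<omega>. \<phi> (Phi0 l \<omega>))"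
    for l i
  proof -
    have "second_moment P (\<lambda>\<omega>. \<phi> (X (l, i) \<omega>)) = second_moment P (\<lambda>\<omega>. a l *\<^sub>R \<phi> (T l i \<omega>))"
      by (intro second_moment_cong) (simp add: X_eq blinfun.scaleR_right)
    also have "\<dots> = ennreal ((a l)\<^sup>2) * second_moment P (\<lambda>\<omega>. \<phi> (T l i \<omega>))"
      by (intro second_moment_scaleR measurable_compose[OF T_meas bphi])
    also have "second_moment P (\<lambda>\<omega>. \<phi> (T l i \<omega>)) = second_moment P (\<lambda>\<omega>. \<phi> (Phi0 l \<omega>))"
      by (rule second_moment_distr[OF T_meas Phi0_meas T_distr bphi])
    finally show ?thesis .
  qed
  have sum_I: "(\<Sum>p\<in>I. f p) = (\<Sum>l = 0..<n. \<Sum>i = 1..m ^ (n - l). f (l, i))"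
    for f :: "nat \<times> nat \<Rightarrow> 'b::comm_monoid_add"
    unfolding I_def by (subst sum.Sigma) auto
  have "second_moment P (\<lambda>\<omega>. \<phi> (Y [0] (int n) \<omega> - y)) = second_moment P (\<lambda>\<omega>. \<phi> ((\<Sum>p\<in>I. X p \<omega>) - y))"
    using Y_rec[OF _ n, of "[0]"]
    by (intro second_moment_cong) (simp add: sum_I X_eq T_def a_def Theta_iff scaleR_sum_right)
  also have "\<dots> \<le> (\<Sum>p\<in>I. second_moment P (\<lambda>\<omega>. \<phi> (X p \<omega>)))
      + ennreal ((norm (\<phi> (y - (\<Sum>p\<in>I. \<integral>\<omega>. X p \<omega> \<partial>P))))\<^sup>2)"
    using second_moment_indep_sum_le[OF fin ind X_int] .
  also have "(\<Sum>p\<in>I. second_moment P (\<lambda>\<omega>. \<phi> (X p \<omega>)))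
      = (\<Sum>l = 0..<n. ennreal (a l) * second_moment P (\<lambda>\<omega>. \<phi> (Phi0 l \<omega>)))"
    unfolding sum_I X_sm
  proof (intro sum.cong refl)
    fix l
    have "of_nat (m ^ (n - l)) * ennreal ((a l)\<^sup>2) = ennreal (real (m ^ (n - l)) * (a l)\<^sup>2)"
      by (simp only: ennreal_of_nat_eq_real_of_nat ennreal_mult'[symmetric] of_nat_0_le_iff)
    also have "real (m ^ (n - l)) * (a l)\<^sup>2 = a l"
      using mp by (simp add: a_def power2_eq_square)
    finally show "(\<Sum>i = 1..m ^ (n - l). ennreal ((a l)\<^sup>2) * second_moment P (\<lambda>\<omega>. \<phi> (Phi0 l \<omega>)))
        = ennreal (a l) * second_moment P (\<lambda>\<omega>. \<phi> (Phi0 l \<omega>))"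
      by (simp flip: mult.assoc)
  qed
  also have "(\<Sum>p\<in>I. \<integral>\<omega>. X p \<omega> \<partial>P) = (\<Sum>l = 0..<n. \<integral>\<omega>. Phi0 l \<omega> \<partial>P)"
    using mp unfolding sum_I X_expect by (simp add: a_def sum_constant_scaleR)
  finally show ?thesis by (simp add: a_def)
qed

section \<open>The recursion for the error\<close>

abbreviation err :: "nat \<Rightarrow> nat \<Rightarrow> ennreal" where
  "err n k \<equiv> second_moment P (\<lambda>\<omega>. \<psi> k \<omega> (Y [0] (int n) \<omega> - y))"

lemma err_le:
  assumes n: "1 \<le> n"
  shows "err n k \<le> (\<Sum>l = 0..<n. ennreal (1 / real m ^ (n - l)) * second_moment P (\<lambda>\<omega>. \<psi> k \<omega> (Phi0 l \<omega>)))
    + ennreal (2 * c) * err (n - 1) (k + 1)"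
proof -
  have T: "[0] \<in> Theta" "[1] \<in> Theta" by (auto simp: Theta_iff)
  define b where "b = y - (\<Sum>l = 0..<n. \<integral>\<omega>. Phi0 l \<omega> \<partial>P)"
  have Phi0_meas: "Phi0 l \<in> borel_measurable Z_alg" for l
    using T by (intro Phi_measurable_alg)
  have sm_meas: "(\<lambda>\<omega>. second_moment P (\<lambda>\<omega>'. \<psi> k \<omega> (Phi0 l \<omega>'))) \<in> borel_measurable P" for l
    by (intro second_moment_psi_measurable' measurable_Z_alg_imp[OF Phi0_meas])
  have b_meas: "(\<lambda>\<omega>. \<psi> k \<omega> b) \<in> borel_measurable P"
    by (rule measurable_blinfun_apply_strong_sigma[OF psi_meas]) simp
  have "err n k = (\<integral>\<^sup>+\<omega>. second_moment P (\<lambda>\<omega>'. \<psi> k \<omega> (Y [0] (int n) \<omega>' - y)) \<partial>P)"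
    by (intro second_moment_psi borel_measurable_diff borel_measurable_const Y_measurable_alg' T)
  also have "\<dots> \<le> (\<integral>\<^sup>+\<omega>. (\<Sum>l = 0..<n. ennreal (1 / real m ^ (n - l)) *
      second_moment P (\<lambda>\<omega>'. \<psi> k \<omega> (Phi0 l \<omega>'))) + ennreal ((norm (\<psi> k \<omega> b))\<^sup>2) \<partial>P)"
    unfolding b_def by (intro nn_integral_mono second_moment_Y_le[OF n])
  also have "\<dots> = (\<Sum>l = 0..<n. ennreal (1 / real m ^ (n - l)) *
      (\<integral>\<^sup>+\<omega>. second_moment P (\<lambda>\<omega>'. \<psi> k \<omega> (Phi0 l \<omega>')) \<partial>P)) + second_moment P (\<lambda>\<omega>. \<psi> k \<omega> b)"
    using sm_meas b_meas
    by (simp add: nn_integral_add nn_integral_sum nn_integral_cmult second_moment_def)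
  also have "\<dots> = (\<Sum>l = 0..<n. ennreal (1 / real m ^ (n - l)) *
      second_moment P (\<lambda>\<omega>. \<psi> k \<omega> (Phi0 l \<omega>))) + second_moment P (\<lambda>\<omega>. \<psi> k \<omega> b)"
    by (simp only: second_moment_psi[OF Phi0_meas])
  also have "second_moment P (\<lambda>\<omega>. \<psi> k \<omega> b) \<le> ennreal (2 * c) * err (n - 1) (k + 1)"
    using psi_bias[OF n, of k] n by (simp add: b_def of_nat_diff)
  finally show ?thesis by (simp add: add_left_mono)
qed

text \<open>Inserting \<open>y\<close> splits the Lipschitz difference into two errors; the square
  of a difference costs a factor 2, which turns \<open>c\<close> into \<open>2 * c\<close>.\<close>

lemma second_moment_psi_Phi0_le_err:
  assumes l: "1 \<le> l"
  shows "second_moment P (\<lambda>\<omega>. \<psi> k \<omega> (Phi0 l \<omega>)) \<le> ennreal (2 * c) * (err l (k + 1) + err (l - 1) (k + 1))"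
proof -
  have T: "[0] \<in> Theta" "[1] \<in> Theta" by (auto simp: Theta_iff)
  have m: "(\<lambda>\<omega>. \<psi> (k + 1) \<omega> (Y \<theta> (int r - 1) \<omega> - y)) \<in> borel_measurable P" if "\<theta> \<in> Theta" for \<theta> r
    by (intro measurable_blinfun_apply_strong_sigma[OF psi_meas] borel_measurable_diff
        borel_measurable_const Y_measurable that)
  \<comment> \<open>Equality in law is known for the iterates alone, not jointly with the operator.
    With the operator frozen this is enough.\<close>
  have law: "second_moment P (\<lambda>\<omega>. \<psi> (k + 1) \<omega> (Y [1] (int l - 1) \<omega> - y)) = err (l - 1) (k + 1)"
  proof -
    have a: "(\<lambda>\<omega>. Y \<theta> (int l - 1) \<omega> - y) \<in> borel_measurable Z_alg" if "\<theta> \<in> Theta" for \<theta>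
      by (intro borel_measurable_diff borel_measurable_const Y_measurable_alg that)
    have "second_moment P (\<lambda>\<omega>'. \<phi> (Y [1] (int l - 1) \<omega>' - y))
        = second_moment P (\<lambda>\<omega>'. \<phi> (Y [0] (int l - 1) \<omega>' - y))" for \<phi> :: "'y \<Rightarrow>\<^sub>L 'h"
      by (rule second_moment_distr[where f = "\<lambda>x. \<phi> (x - y)"])
        (auto intro!: Y_measurable T Y_distr borel_measurable_continuous_onI continuous_intros)
    then have "second_moment P (\<lambda>\<omega>. \<psi> (k + 1) \<omega> (Y [1] (int l - 1) \<omega> - y))
        = second_moment P (\<lambda>\<omega>. \<psi> (k + 1) \<omega> (Y [0] (int l - 1) \<omega> - y))"
      by (simp only: second_moment_psi[OF a[OF T(1)]] second_moment_psi[OF a[OF T(2)]])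
    then show ?thesis using l by (simp add: of_nat_diff)
  qed
  have "second_moment P (\<lambda>\<omega>. \<psi> k \<omega> (Phi0 l \<omega>))
      \<le> ennreal c * second_moment P (\<lambda>\<omega>. \<psi> (k + 1) \<omega> (Y [0] (int l) \<omega> - Y [1] (int l - 1) \<omega>))"
    by (rule second_moment_psi_Phi0_le[OF l])
  also have "second_moment P (\<lambda>\<omega>. \<psi> (k + 1) \<omega> (Y [0] (int l) \<omega> - Y [1] (int l - 1) \<omega>))
      = second_moment P (\<lambda>\<omega>. \<psi> (k + 1) \<omega> (Y [0] (int l) \<omega> - y) - \<psi> (k + 1) \<omega> (Y [1] (int l - 1) \<omega> - y))"
    by (simp add: blinfun.diff_right)
  also have "\<dots> \<le> 2 * err l (k + 1) + 2 * err (l - 1) (k + 1)"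
    using second_moment_diff_le[OF m[OF T(1), of "Suc l"] m[OF T(2), of l]] law by simp
  also have "ennreal c * (2 * err l (k + 1) + 2 * err (l - 1) (k + 1))
      = ennreal (2 * c) * (err l (k + 1) + err (l - 1) (k + 1))"
    using c_pos by (simp add: ennreal_mult' algebra_simps)
  finally show ?thesis by (simp add: mult_left_mono)
qed

text \<open>The case \<open>n = k = 0\<close> is excluded because the hypothesis on
  \<open>y_0 - y\<close> starts at \<open>k = 1\<close>. The induction never meets it, as the
  recursion refers to \<open>k + 1\<close> only.\<close>

lemma err_le_picard_bound:
  assumes "1 \<le> n \<or> 1 \<le> k"
  shows "err n k \<le> ennreal (picard_bound c C m n k)"
  using assms
proof (induction n arbitrary: k rule: less_induct)
  case (less n)
  let ?b = "\<lambda>l. picard_bound c C m l (k + 1)"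
  have b0: "0 \<le> ?b l" for l using c_pos by (intro picard_bound_nonneg) auto
  show ?case
  proof (cases "n = 0")
    case True
    then have "err n k = second_moment P (\<lambda>\<omega>. \<psi> k \<omega> (y_0 - y))"
      using Y_0[of "[0]"] by (intro second_moment_cong) (simp add: Theta_iff)
    then show ?thesis
      using psi_bound_diff[of k] less.prems True by (simp add: picard_bound_def)
  next
    case False
    then have n: "1 \<le> n" by simp
    have IH: "err l (k + 1) \<le> ennreal (?b l)" if "l < n" for l
      using less.IH[OF that, of "k + 1"] by simp
    have zero: "second_moment P (\<lambda>\<omega>. \<psi> k \<omega> (Phi0 0 \<omega>)) \<le> ennreal (C\<^sup>2 / fact k)"
    proof -
      have "second_moment P (\<lambda>\<omega>. \<psi> k \<omega> (Phi0 0 \<omega>)) = second_moment P (\<lambda>\<omega>. \<psi> k \<omega> (\<Phi> 0 (y_0, y_m1, Z [0] \<omega>)))"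
        using Y_0[of "[0]"] Y_m1[of "[1]"] by (intro second_moment_cong) (simp add: Theta_iff)
      then show ?thesis using psi_bound_Phi[of k] by simp
    qed
    have pos: "second_moment P (\<lambda>\<omega>. \<psi> k \<omega> (Phi0 l \<omega>)) \<le> ennreal (2 * c * (?b l + ?b (l - 1)))"
      if "l \<in> {1..<n}" for l
    proof -
      have "second_moment P (\<lambda>\<omega>. \<psi> k \<omega> (Phi0 l \<omega>)) \<le> ennreal (2 * c) * (err l (k + 1) + err (l - 1) (k + 1))"
        using that by (intro second_moment_psi_Phi0_le_err) auto
      also have "\<dots> \<le> ennreal (2 * c) * (ennreal (?b l) + ennreal (?b (l - 1)))"
        using that by (intro mult_left_mono add_mono IH) auto
      also have "\<dots> = ennreal (2 * c * (?b l + ?b (l - 1)))"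
        using b0 c_pos by (simp add: ennreal_mult ennreal_plus)
      finally show ?thesis .
    qed
    let ?s = "\<lambda>l. ennreal (1 / real m ^ (n - l)) * second_moment P (\<lambda>\<omega>. \<psi> k \<omega> (Phi0 l \<omega>))"
    have "err n k \<le> (\<Sum>l = 0..<n. ?s l) + ennreal (2 * c) * err (n - 1) (k + 1)"
      by (rule err_le[OF n])
    also have "(\<Sum>l = 0..<n. ?s l) = ?s 0 + (\<Sum>l = 1..<n. ?s l)"
      using n by (simp add: sum.atLeast_Suc_lessThan)
    also have "?s 0 + (\<Sum>l = 1..<n. ?s l) + ennreal (2 * c) * err (n - 1) (k + 1)
      \<le> ennreal (1 / real m ^ n) * ennreal (C\<^sup>2 / fact k)
        + (\<Sum>l = 1..<n. ennreal (1 / real m ^ (n - l)) * ennreal (2 * c * (?b l + ?b (l - 1))))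
        + ennreal (2 * c) * ennreal (?b (n - 1))"
      using n zero by (intro add_mono sum_mono pos IH mult_mono) auto
    \<comment> \<open>All terms are nonnegative reals, so the estimate moves to the reals, where
      \<open>picard_bound_rec\<close> applies.\<close>
    also have "\<dots> = ennreal (1 / real m ^ n * (C\<^sup>2 / fact k)
        + (\<Sum>l = 1..<n. 1 / real m ^ (n - l) * (2 * c * (?b l + ?b (l - 1))))
        + 2 * c * ?b (n - 1))"
    proof -
      have nn: "0 \<le> 1 / real m ^ (n - l) * (2 * c * (?b l + ?b (l - 1)))" for l
        using b0 c_pos by (intro mult_nonneg_nonneg add_nonneg_nonneg) auto
      have "(\<Sum>l = 1..<n. ennreal (1 / real m ^ (n - l)) * ennreal (2 * c * (?b l + ?b (l - 1))))
        = ennreal (\<Sum>l = 1..<n. 1 / real m ^ (n - l) * (2 * c * (?b l + ?b (l - 1))))"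
      proof -
        have "ennreal (1 / real m ^ (n - l)) * ennreal (2 * c * (?b l + ?b (l - 1)))
          = ennreal (1 / real m ^ (n - l) * (2 * c * (?b l + ?b (l - 1))))" for l
          using b0 c_pos by (intro ennreal_mult[symmetric]) auto
        then show ?thesis using nn by (simp only: sum_ennreal)
      qed
      moreover have "ennreal (1 / real m ^ n) * ennreal (C\<^sup>2 / fact k) = ennreal (1 / real m ^ n * (C\<^sup>2 / fact k))"
        by (intro ennreal_mult[symmetric]) auto
      moreover have "ennreal (2 * c) * ennreal (?b (n - 1)) = ennreal (2 * c * ?b (n - 1))"
        using b0 c_pos by (intro ennreal_mult[symmetric]) auto
      moreover have "0 \<le> (\<Sum>l = 1..<n. 1 / real m ^ (n - l) * (2 * c * (?b l + ?b (l - 1))))"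
        by (intro sum_nonneg nn)
      moreover have "0 \<le> 1 / real m ^ n * (C\<^sup>2 / fact k)" "0 \<le> 2 * c * ?b (n - 1)"
        using b0 c_pos by auto
      ultimately show ?thesis by (simp only: ennreal_plus add_nonneg_nonneg)
    qed
    also have "\<dots> \<le> ennreal (picard_bound c C m n k)"
      using picard_bound_rec[OF c_pos _ n, of "real m" C k] m_pos by (intro ennreal_leI) simp
    finally show ?thesis .
  qed
qed

end

section \<open>The complexity theorem\<close>

theorem corollary2p15:
  fixes P :: "'w measure"
    and \<zz> \<gamma> \<BB> \<kappa> C c :: real
    and M :: "nat \<Rightarrow> nat"
    and y y_m1 y_0 :: "'y :: {banach, second_countable_topology}"
    and MZ :: "'z measure"
    and Z :: "int list \<Rightarrow> 'w \<Rightarrow> 'z"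
    and \<psi> :: "nat \<Rightarrow> 'w \<Rightarrow>
                ('y \<Rightarrow>\<^sub>L 'h :: {real_inner, complete_space, second_countable_topology})"
    and \<Phi> :: "nat \<Rightarrow> 'y \<times> 'y \<times> 'z \<Rightarrow> 'y"
    and Y :: "int list \<Rightarrow> int \<Rightarrow> nat \<Rightarrow> 'w \<Rightarrow> 'y"
    and Cost :: "int \<Rightarrow> nat \<Rightarrow> real"
  assumes prob: "prob_space P"
    and params: "0 \<le> \<zz>" "0 \<le> \<gamma>" "1 \<le> \<BB>" "1 \<le> \<kappa>" "1 \<le> C" "0 < c"
    and M_pos: "\<And>j. j \<ge> 1 \<Longrightarrow> M j \<ge> 1"
    and M_liminf: "liminf (\<lambda>j. ereal (real (M j))) = \<infinity>"
    and M_ratio: "(SUP j\<in>{1..}. ereal (real (M (j + 1)) / real (M j))) \<le> ereal \<BB>"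
    and M_linear: "(SUP j\<in>{1..}. ereal (real (M j) / real j)) \<le> ereal \<kappa>"
    and Z_indep: "prob_space.indep_vars P (\<lambda>_. MZ) Z Theta"
    and Z_ident: "\<And>\<theta> \<theta>'. \<theta> \<in> Theta \<Longrightarrow> \<theta>' \<in> Theta \<Longrightarrow>
                    distr P MZ (Z \<theta>) = distr P MZ (Z \<theta>')"
    and psi_meas: "\<And>k. \<psi> k \<in> measurable P strong_sigma"
    and Z_psi_indep: "prob_space.indep_set P
                        (generated_sigma P Theta MZ Z) (generated_sigma P UNIV strong_sigma \<psi>)"
    and Phi_meas: "\<And>l. \<Phi> l \<in> measurable (borel \<Otimes>\<^sub>M borel \<Otimes>\<^sub>M MZ) borel"
    and Y_m1: "\<And>\<theta> j \<omega>. \<theta> \<in> Theta \<Longrightarrow> j \<ge> 1 \<Longrightarrow> \<omega> \<in> space P \<Longrightarrow> Y \<theta> (-1) j \<omega> = y_m1"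
    and Y_0: "\<And>\<theta> j \<omega>. \<theta> \<in> Theta \<Longrightarrow> j \<ge> 1 \<Longrightarrow> \<omega> \<in> space P \<Longrightarrow> Y \<theta> 0 j \<omega> = y_0"
    and Y_rec: "\<And>\<theta> (n::nat) j \<omega>. \<theta> \<in> Theta \<Longrightarrow> n \<ge> 1 \<Longrightarrow> j \<ge> 1 \<Longrightarrow> \<omega> \<in> space P \<Longrightarrow>
        Y \<theta> (int n) j \<omega> =
          (\<Sum>l = 0..<n. (1 / real (M j) ^ (n - l)) *\<^sub>R
             (\<Sum>i = 1..(M j) ^ (n - l).
                \<Phi> l (Y (\<theta> @ [int l, int i]) (int l) j \<omega>,
                     Y (\<theta> @ [- int l, int i]) (int l - 1) j \<omega>,
                     Z (\<theta> @ [int l, int i]) \<omega>)))"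
    and Cost_nonneg: "\<And>n j. n \<ge> -1 \<Longrightarrow> j \<ge> 1 \<Longrightarrow> 0 \<le> Cost n j"
    and Cost_m1: "\<And>j. j \<ge> 1 \<Longrightarrow> Cost (-1) j = 0"
    and Cost_0: "\<And>j. j \<ge> 1 \<Longrightarrow> Cost 0 j = 0"
    and Cost_rec: "\<And>(n::nat) j. n \<ge> 1 \<Longrightarrow> j \<ge> 1 \<Longrightarrow>
        Cost (int n) j \<le> real (M j) ^ n * \<zz> +
          (\<Sum>l = 0..<n. real (M j) ^ (n - l) *
             (Cost (int l) j + Cost (int l - 1) j + \<gamma> * \<zz>))"
    and Phi_integrable: "\<And>k j. j \<ge> 1 \<Longrightarrow>
        (\<integral>\<^sup>+\<omega>. ennreal (norm (\<Phi> k (Y [0] (int k) j \<omega>, Y [1] (int k - 1) j \<omega>, Z [0] \<omega>))) \<partial>P) < \<infinity>"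
    and psi_bound: "\<And>k.
        max (second_moment P (\<lambda>\<omega>. \<psi> k \<omega> (\<Phi> 0 (y_0, y_m1, Z [0] \<omega>))))
            (indicator {1..} k * second_moment P (\<lambda>\<omega>. \<psi> k \<omega> (y_0 - y)))
          \<le> ennreal (C\<^sup>2 / fact k)"
    and psi_Lipschitz: "\<And>k n u v. n \<ge> 1 \<Longrightarrow>
        second_moment P (\<lambda>\<omega>. \<psi> k \<omega> (\<Phi> n (u, v, Z [0] \<omega>)))
          \<le> ennreal c * second_moment P (\<lambda>\<omega>. \<psi> (k + 1) \<omega> (u - v))"
    and psi_bias: "\<And>k (n::nat) j. n \<ge> 1 \<Longrightarrow> j \<ge> 1 \<Longrightarrow>
        second_moment P (\<lambda>\<omega>. \<psi> k \<omega> (y -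
            (\<Sum>l = 0..<n. \<integral>\<omega>'. \<Phi> l (Y [0] (int l) j \<omega>', Y [1] (int l - 1) j \<omega>', Z [0] \<omega>') \<partial>P)))
          \<le> ennreal (2 * c) * second_moment P (\<lambda>\<omega>. \<psi> (k + 1) \<omega> (Y [0] (int n - 1) j \<omega> - y))"
  shows "(\<forall>n::nat. n \<ge> 1 \<longrightarrow>
            ennreal_sqrt (second_moment P (\<lambda>\<omega>. \<psi> 0 \<omega> (Y [0] (int n) n \<omega> - y)))
              \<le> ennreal (C * (exp \<kappa> * (1 + 4 * c) / real (M n)) powr (real n / 2)) \<and>
            ennreal (C * (exp \<kappa> * (1 + 4 * c) / real (M n)) powr (real n / 2)) < \<infinity>) \<and>
         (\<forall>n::nat. n \<ge> 1 \<longrightarrow> Cost (int n) n \<le> (3 + \<gamma>) ^ n * real (M n) ^ n * \<zz>) \<and>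
         (\<exists>N :: real \<Rightarrow> nat.
            (\<forall>\<epsilon>\<in>{0<..1}. N \<epsilon> \<ge> 1) \<and>
            (\<forall>\<epsilon>\<in>{0<..1}. \<forall>\<delta>\<in>{0<..}.
               (SUP n\<in>{N \<epsilon>..}.
                  ennreal_sqrt (second_moment P (\<lambda>\<omega>. \<psi> 0 \<omega> (Y [0] (int n) n \<omega> - y))))
                 \<le> ennreal \<epsilon> \<and>
               ennreal (Cost (int (N \<epsilon>)) (N \<epsilon>))
                 \<le> ennreal (\<zz> * (3 + \<gamma>) * exp \<kappa> * C powr (2 * (1 + \<delta>))) *
                     (1 + (SUP n\<in>{1..}.
                        ennreal (((\<BB> * exp (2 * \<kappa>) * (3 + \<gamma>) * (1 + 4 * c)) powr (1 + \<delta>)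
                                    / real (M n) powr \<delta>) ^ n))) *
                     ennreal (\<epsilon> powr (- 2 * (1 + \<delta>))) \<and>
               ennreal (\<zz> * (3 + \<gamma>) * exp \<kappa> * C powr (2 * (1 + \<delta>))) *
                     (1 + (SUP n\<in>{1..}.
                        ennreal (((\<BB> * exp (2 * \<kappa>) * (3 + \<gamma>) * (1 + 4 * c)) powr (1 + \<delta>)
                                    / real (M n) powr \<delta>) ^ n))) *
                     ennreal (\<epsilon> powr (- 2 * (1 + \<delta>))) < \<infinity>))"
proof -
  interpret prob_space P by (rule prob)
  define q where "q = 3 + \<gamma>"
  define rate where "rate = (\<lambda>n. C * (exp \<kappa> * (1 + 4 * c) / real (M n)) powr (real n / 2))"
  define error where
    "error = (\<lambda>n. ennreal_sqrt (second_moment P (\<lambda>\<omega>. \<psi> 0 \<omega> (Y [0] (int n) n \<omega> - y))))"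
  define bound where "bound = (\<lambda>\<epsilon> \<delta>. ennreal (\<zz> * q * exp \<kappa> * C powr (2 * (1 + \<delta>))) *
    (1 + (SUP n\<in>{1..}. ennreal (((\<BB> * exp (2 * \<kappa>) * q * (1 + 4 * c)) powr (1 + \<delta>)
        / real (M n) powr \<delta>) ^ n))) * ennreal (\<epsilon> powr (- 2 * (1 + \<delta>))))"
  have q: "1 \<le> q" using params by (simp add: q_def)
  have M1: "1 \<le> real (M j)" if "1 \<le> j" for j using M_pos[OF that] by simp
  have M_\<kappa>: "real (M j) \<le> \<kappa> * real j" if "1 \<le> j" for j
  proof -
    have "ereal (real (M j) / real j) \<le> ereal \<kappa>"
      using that by (intro order_trans[OF _ M_linear] SUP_upper) auto
    then show ?thesis using that by (simp add: field_simps)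
  qed
  have M_\<BB>: "real (M (Suc j)) \<le> \<BB> * real (M j)" if "1 \<le> j" for j
  proof -
    have "ereal (real (M (j + 1)) / real (M j)) \<le> ereal \<BB>"
      using that by (intro order_trans[OF _ M_ratio] SUP_upper) auto
    then show ?thesis using M1[OF that] by (simp add: field_simps)
  qed
  have M_lim: "filterlim (\<lambda>n. real (M n)) at_top sequentially"
    unfolding filterlim_at_top
  proof
    fix b :: real
    have "eventually (\<lambda>j. ereal b < ereal (real (M j))) sequentially"
      by (rule less_LiminfD) (simp add: M_liminf)
    then show "eventually (\<lambda>j. b \<le> real (M j)) sequentially"
      by eventually_elim simp
  qed
  have error_le: "error n \<le> ennreal (rate n)" if n: "1 \<le> n" for n
  proof -
    \<comment> \<open>The scheme is used with level and sample size coupled, that is at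
      \<open>j = n\<close>.\<close>
    interpret S: mlp P "M n" c C y y_m1 y_0 MZ Z \<psi> \<Phi> "\<lambda>\<theta> i. Y \<theta> i n"
    proof unfold_locales
      fix k
      show "second_moment P (\<lambda>\<omega>. \<psi> k \<omega> (\<Phi> 0 (y_0, y_m1, Z [0] \<omega>))) \<le> ennreal (C\<^sup>2 / fact k)"
        using psi_bound[of k] by simp
      show "second_moment P (\<lambda>\<omega>. \<psi> k \<omega> (y_0 - y)) \<le> ennreal (C\<^sup>2 / fact k)" if "1 \<le> k"
        using psi_bound[of k] that by simp
    qed (fact M_pos[OF n] params Z_indep Z_ident psi_meas Z_psi_indep Phi_meas
        Y_m1[OF _ n] Y_0[OF _ n] Y_rec[OF _ _ n] Phi_integrable[OF n] psi_Lipschitz psi_bias[OF _ n])+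
    have "second_moment P (\<lambda>\<omega>. \<psi> 0 \<omega> (Y [0] (int n) n \<omega> - y)) \<le> ennreal (picard_bound c C (M n) n 0)"
      using n by (intro S.err_le_picard_bound) auto
    also have "\<dots> \<le> ennreal ((rate n)\<^sup>2)"
      unfolding rate_def using params M1[OF n] M_\<kappa>[OF n]
      by (intro ennreal_leI picard_bound_le_rate) auto
    finally show ?thesis
      unfolding error_def using params by (intro ennreal_sqrt_le) (auto simp: rate_def)
  qed
  have cost_le: "Cost (int n) n \<le> q ^ n * real (M n) ^ n * \<zz>" if n: "1 \<le> n" for n
    unfolding q_def
    using params M1[OF n] Cost_m1[OF n] Cost_0[OF n] Cost_rec[OF _ n] n
    by (intro picard_cost_le[where Cost = "\<lambda>i. Cost i n"]) auto
  have bound_finite: "bound \<epsilon> \<delta> < \<infinity>" if "0 < \<delta>" for \<epsilon> \<delta>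
    using SUP_power_quotient_finite[OF M_lim _ that, of "(\<BB> * exp (2 * \<kappa>) * q * (1 + 4 * c)) powr (1 + \<delta>)"]
    by (auto simp: bound_def ennreal_mult_less_top)
  \<comment> \<open>\<open>N\<close> depends on \<open>\<epsilon>\<close> alone;
    \<open>\<delta>\<close> enters only when the cost at \<open>N \<epsilon>\<close> is
    estimated.\<close>
  define N where "N = (\<lambda>\<epsilon>. LEAST n. 1 \<le> n \<and> (\<forall>i\<ge>n. rate i \<le> \<epsilon>))"
  have N: "1 \<le> N \<epsilon> \<and> (\<forall>i\<ge>N \<epsilon>. rate i \<le> \<epsilon>)" if "0 < \<epsilon>" for \<epsilon>
  proof -
    have "eventually (\<lambda>n. rate n \<le> \<epsilon>) sequentially"
      unfolding rate_def using params that by (intro eventually_rate_le M_lim) auto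
    then obtain n where "\<forall>i\<ge>n. rate i \<le> \<epsilon>" unfolding eventually_sequentially by blast
    then have "1 \<le> max 1 n \<and> (\<forall>i\<ge>max 1 n. rate i \<le> \<epsilon>)" by simp
    then show ?thesis unfolding N_def by (rule LeastI)
  qed
  have error_N: "(SUP n\<in>{N \<epsilon>..}. error n) \<le> ennreal \<epsilon>" if "0 < \<epsilon>" for \<epsilon>
  proof (rule SUP_least)
    fix n assume "n \<in> {N \<epsilon>..}"
    then show "error n \<le> ennreal \<epsilon>"
      using N[OF that] by (intro order_trans[OF error_le ennreal_leI]) auto
  qed
  have cost_N: "ennreal (Cost (int (N \<epsilon>)) (N \<epsilon>)) \<le> bound \<epsilon> \<delta>"
    if \<epsilon>: "0 < \<epsilon>" "\<epsilon> \<le> 1" and \<delta>: "0 < \<delta>" for \<epsilon> \<delta>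
  proof -
    let ?a = "\<zz> * q * exp \<kappa> * C powr (2 * (1 + \<delta>))"
    let ?K = "\<lambda>n. ((\<BB> * exp (2 * \<kappa>) * q * (1 + 4 * c)) powr (1 + \<delta>) / real (M n) powr \<delta>) ^ n"
    let ?b = "\<epsilon> powr (- 2 * (1 + \<delta>))"
    have a0: "0 \<le> ?a" using params q by simp
    have K0: "0 \<le> ?K n" for n by simp
    show ?thesis
    proof (cases "N \<epsilon> = 1")
      \<comment> \<open>There is no admissible predecessor here. The summand 1 next to the supremum
        pays for the cost, because \<open>M 1 \<le> \<kappa> \<le> exp \<kappa>\<close>.\<close>
      case True
      have "1 \<le> C powr (2 * (1 + \<delta>))" using params \<delta> by (intro ge_one_powr_ge_zero) auto
      moreover have "1 \<le> ?b"
      proof -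
        have "\<epsilon> powr 0 \<le> ?b" using \<epsilon> \<delta> by (intro powr_mono') auto
        then show ?thesis using \<epsilon> by simp
      qed
      ultimately have Cb: "1 * 1 \<le> C powr (2 * (1 + \<delta>)) * ?b" by (intro mult_mono) auto
      have "Cost (int (N \<epsilon>)) (N \<epsilon>) \<le> q * real (M 1) * \<zz>"
        using cost_le[of 1] True by simp
      also have "\<dots> \<le> q * exp \<kappa> * \<zz>"
      proof -
        have "real (M 1) \<le> exp \<kappa>" using M_\<kappa>[of 1] exp_ge_add_one_self[of \<kappa>] by linarith
        then show ?thesis using q params by (intro mult_right_mono mult_left_mono) auto
      qed
      also have "\<dots> \<le> q * exp \<kappa> * \<zz> * (C powr (2 * (1 + \<delta>)) * ?b)"
        using mult_left_mono[OF Cb, of "q * exp \<kappa> * \<zz>"] q params by simp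
      finally have "Cost (int (N \<epsilon>)) (N \<epsilon>) \<le> ?a * ?b" by (simp add: mult_ac)
      then have "ennreal (Cost (int (N \<epsilon>)) (N \<epsilon>)) \<le> ennreal (?a * ?b)" by (rule ennreal_leI)
      also have "\<dots> = ennreal ?a * 1 * ennreal ?b" using a0 by (simp add: ennreal_mult)
      also have "\<dots> \<le> bound \<epsilon> \<delta>" unfolding bound_def by (intro mult_mono) auto
      finally show ?thesis .
    next
      case False
      then obtain m where m: "1 \<le> m" "N \<epsilon> = Suc m"
        using N[OF \<epsilon>(1)] by (cases "N \<epsilon>") auto
      \<comment> \<open>By minimality the rate exceeds \<open>\<epsilon>\<close> at some index from
        \<open>m\<close> on; since it does not at any later index, this index is \<open>m\<close>
        itself.\<close>
      have "\<not> (1 \<le> m \<and> (\<forall>i\<ge>m. rate i \<le> \<epsilon>))"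
        using m(2) unfolding N_def by (intro not_less_Least) simp
      then obtain i where "m \<le> i" "\<epsilon> < rate i" using m(1) by (auto simp: not_le)
      moreover have "rate i \<le> \<epsilon>" if "Suc m \<le> i" for i using N[OF \<epsilon>(1)] m that by auto
      ultimately have rate_m: "\<epsilon> < rate m" by (metis not_less_eq_eq not_le le_antisym)
      have "q ^ Suc m * real (M (Suc m)) ^ Suc m \<le> q * exp \<kappa> * C powr (2 * (1 + \<delta>)) * ?K m * ?b"
        by (rule cost_of_minimal_index_le)
          (use params M1 M_\<BB> M_\<kappa>[of "Suc m"] m q \<epsilon> \<delta> rate_m in \<open>auto simp: rate_def\<close>)
      then have "\<zz> * (q ^ Suc m * real (M (Suc m)) ^ Suc m) \<le> \<zz> * (q * exp \<kappa> * C powr (2 * (1 + \<delta>)) * ?K m * ?b)"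
        using params by (intro mult_left_mono)
      then have "Cost (int (N \<epsilon>)) (N \<epsilon>) \<le> ?a * ?K m * ?b"
        using cost_le[of "Suc m"] m(2) by (simp add: mult_ac)
      then have "ennreal (Cost (int (N \<epsilon>)) (N \<epsilon>)) \<le> ennreal (?a * ?K m * ?b)" by (rule ennreal_leI)
      also have "\<dots> = ennreal ?a * ennreal (?K m) * ennreal ?b"
        using a0 K0[of m] by (simp only: ennreal_mult mult_nonneg_nonneg powr_ge_zero)
      also have "\<dots> \<le> bound \<epsilon> \<delta>"
      proof -
        have "ennreal (?K m) \<le> (SUP n\<in>{1..}. ennreal (?K n))" using m(1) by (intro SUP_upper) auto
        then have "ennreal (?K m) \<le> 1 + (SUP n\<in>{1..}. ennreal (?K n))"
          by (rule add_increasing[OF zero_le])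
        then show ?thesis unfolding bound_def by (intro mult_mono) auto
      qed
      finally show ?thesis .
    qed
  qed
  have "(\<forall>n\<ge>1. error n \<le> ennreal (rate n) \<and> ennreal (rate n) < \<infinity>) \<and>
    (\<forall>n\<ge>1. Cost (int n) n \<le> q ^ n * real (M n) ^ n * \<zz>) \<and>
    (\<exists>N :: real \<Rightarrow> nat. (\<forall>\<epsilon>\<in>{0<..1}. N \<epsilon> \<ge> 1) \<and>
      (\<forall>\<epsilon>\<in>{0<..1}. \<forall>\<delta>\<in>{0<..}. (SUP n\<in>{N \<epsilon>..}. error n) \<le> ennreal \<epsilon> \<and>
        ennreal (Cost (int (N \<epsilon>)) (N \<epsilon>)) \<le> bound \<epsilon> \<delta> \<and> bound \<epsilon> \<delta> < \<infinity>))"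
    using error_le cost_le N error_N cost_N bound_finite
    by (intro conjI exI[of _ N]) auto
  then show ?thesis
    unfolding error_def bound_def rate_def q_def .
qed

end
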